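(* Let $\mathcal{G}=(G^0,\mathcal{G}^1,r,s)$ be an ultragraph with at least one edge, let $R$ be a nonzero unital commutative ring, and let $\mathbb{F}$ be the free group generated by $\mathcal{G}^1$. Then $L_R(\mathcal{G})$, with its $\mathbb{F}$-grading, is epsilon-strongly $\mathbb{F}$-graded if and only if $G^0\in\mathcal{G}^0$.
   Context: An ultragraph $\mathcal{G}=(G^0,\mathcal{G}^1,r,s)$ consists of two countable sets $G^0$ (vertices) and $\mathcal{G}^1$ (edges), a map $s:\mathcal{G}^1\to G^0$ and a map $r:\mathcal{G}^1\to P(G^0)\setminus\{\emptyset\}$, where $P(G^0)$ is the power set of $G^0$. $\mathcal{G}^0$ (the set of generalized vertices) is the smallest subset of $P(G^0)$ that contains $\{v\}$ for all $v\in G^0$, contains $r(e)$ for all $e\in\mathcal{G}^1$, and is closed under finite unions and non-empty finite intersections. For a unital commutative ring $R$, $L_R(\mathcal{G})$ is the universal $R$-algebra with generators $\{s_e,s_e^*:e\in\mathcal{G}^1\}\cup\{p_A:A\in\mathcal{G}^0\}$ and relations: (1) $p_\emptyset=0$, $p_Ap_B=p_{A\cap B}$, $p_{A\cup B}=p_A+p_B-p_{A\cap B}$ for all $A,B\in\mathcal{G}^0$; (2) $p_{s(e)}s_e=s_ep_{r(e)}=s_e$ and $p_{r(e)}s_e^*=s_e^*p_{s(e)}=s_e^*$ for all $e\in\mathcal{G}^1$; (3) $s_e^*s_f=\delta_{e,f}p_{r(e)}$ for all $e,f\in\mathcal{G}^1$; (4) $p_v=\sum_{s(e)=v}s_es_e^*$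 whenever $0<|s^{-1}(v)|<\infty$. Here $p_v$ means $p_{\{v\}}$. A finite path is either an element of $\mathcal{G}^0$ (of length $0$) or a sequence of edges $e_1\cdots e_n$ (of length $n$) with $s(e_{i+1})\in r(e_i)$ for $1\le i<n$. For $\alpha=e_1\cdots e_n$, $s_\alpha=s_{e_1}\cdots s_{e_n}$ and $s_\alpha^*=s_{e_n}^*\cdots s_{e_1}^*$; for $A\in\mathcal{G}^0$, $s_A=s_A^*=p_A$. The $\mathbb{F}$-grading on $L_R(\mathcal{G})$ is the one in which each $p_A$ is homogeneous of degree the neutral element, each $s_e$ is homogeneous of degree $e$, and each $s_e^*$ is homogeneous of degree $e^{-1}$: the component of degree $t\in\mathbb{F}$ is the $R$-span of the elements $s_\alpha p_As_\beta^*$ with $A\in\mathcal{G}^0$ and $\alpha,\beta$ finite paths such that $\alpha\beta^{-1}=t$ in $\mathbb{F}$ (paths of length zero being read as the neutral element). A grading $\{T_g\}_{g\in\Gamma}$ of a ring $T$ by a group $\Gamma$ is epsilon-strong if for each $g\in\Gamma$ the $(T_gT_{g^{-1}},T_{g^{-1}}T_g)$-bimodule $T_g$ is unital; equivalently, for each $g\in\Gamma$ there is $\epsilon_g\in T_gT_{g^{-1}}$ such that $\epsilon_gs=s=s\epsilon_{g^{-1}}$ for all $s\in T_g$. Here $T_gT_h$ denotes the set of finite sums of products. *)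

theory Defs
  imports
    "HOL-Algebra.AbelCoset"
    "HOL-Algebra.Module"
    "HOL-Library.Poly_Mapping"
    "HOL-Library.Countable_Set"
begin

section \<open>Ultragraphs\<close>

record ('v, 'e) ultragraph =
  verts :: "'v set"
  edges :: "'e set"
  src :: "'e \<Rightarrow> 'v"
  rng :: "'e \<Rightarrow> 'v set"

locale ultragraph =
  fixes G :: "('v, 'e) ultragraph"
  assumes countable_verts: "countable (verts G)"
    and countable_edges: "countable (edges G)"
    and src_closed: "e \<in> edges G \<Longrightarrow> src G e \<in> verts G"
    and rng_closed: "e \<in> edges G \<Longrightarrow> rng G e \<subseteq> verts G"
    and rng_nonempty: "e \<in> edges G \<Longrightarrow> rng G e \<noteq> {}"

text \<open>Generalized vertices. The empty set is the empty finite union; intersections are taken of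
  non-empty finite families.\<close>

inductive_set gen_verts :: "('v, 'e) ultragraph \<Rightarrow> 'v set set"
  for G :: "('v, 'e) ultragraph" where
  empty: "{} \<in> gen_verts G"
| vertex: "v \<in> verts G \<Longrightarrow> {v} \<in> gen_verts G"
| range: "e \<in> edges G \<Longrightarrow> rng G e \<in> gen_verts G"
| union: "A \<in> gen_verts G \<Longrightarrow> B \<in> gen_verts G \<Longrightarrow> A \<union> B \<in> gen_verts G"
| inter: "A \<in> gen_verts G \<Longrightarrow> B \<in> gen_verts G \<Longrightarrow> A \<inter> B \<in> gen_verts G"

datatype ('v, 'e) fpath = GenVertex "'v set" | EdgePath "'e list"

fun is_fpath :: "('v, 'e) ultragraph \<Rightarrow> ('v, 'e) fpath \<Rightarrow> bool" where
  "is_fpath G (GenVertex A) \<longleftrightarrow> A \<in> gen_verts G"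
| "is_fpath G (EdgePath es) \<longleftrightarrow> es \<noteq> [] \<and> set es \<subseteq> edges G \<and>
     (\<forall>i. Suc i < length es \<longrightarrow> src G (es ! Suc i) \<in> rng G (es ! i))"


section \<open>The free group on a set\<close>

text \<open>Elements are reduced words; the letter \<open>(x, True)\<close> stands for the generator \<open>x\<close> and
  \<open>(x, False)\<close> for its inverse.\<close>

definition inv_letter :: "'x \<times> bool \<Rightarrow> 'x \<times> bool" where
  "inv_letter l = (fst l, \<not> snd l)"

definition reduced :: "('x \<times> bool) list \<Rightarrow> bool" where
  "reduced w \<longleftrightarrow> (\<forall>i. Suc i < length w \<longrightarrow> w ! Suc i \<noteq> inv_letter (w ! i))"

fun prefix_letter :: "'x \<times> bool \<Rightarrow> ('x \<times> bool) list \<Rightarrow> ('x \<times> bool) list" where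
  "prefix_letter l [] = [l]"
| "prefix_letter l (k # w) = (if k = inv_letter l then w else l # k # w)"

definition free_group :: "'x set \<Rightarrow> ('x \<times> bool) list monoid" where
  "free_group X = \<lparr>carrier = {w. reduced w \<and> fst ` set w \<subseteq> X},
     mult = (\<lambda>u w. foldr prefix_letter u w), one = []\<rparr>"

lemma inv_letter_simps [simp]:
  "inv_letter (inv_letter l) = l" "fst (inv_letter l) = fst l" "inv_letter l \<noteq> l"
  "l \<noteq> inv_letter l"
  by (auto simp: inv_letter_def prod_eq_iff)

lemma reduced_simps [simp]:
  "reduced []" "reduced [l]"
  "reduced (l # k # w) \<longleftrightarrow> k \<noteq> inv_letter l \<and> reduced (k # w)"
  unfolding reduced_def
  by (auto simp: less_Suc_eq_0_disj all_conj_distrib)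

lemma reduced_ConsD: "reduced (l # w) \<Longrightarrow> reduced w"
  by (cases w) auto

lemma reduced_prefix_letter: "reduced w \<Longrightarrow> reduced (prefix_letter l w)"
  by (cases w) (auto dest: reduced_ConsD)

lemma prefix_letter_inverse:
  "reduced w \<Longrightarrow> prefix_letter l (prefix_letter (inv_letter l) w) = w"
proof (cases w)
  case (Cons k u)
  assume "reduced w"
  with Cons show ?thesis by (cases u) auto
qed simp

lemma prefix_letter_Cons: "reduced (l # w) \<Longrightarrow> prefix_letter l w = l # w"
  by (cases w) auto

lemma set_prefix_letter: "set (prefix_letter l w) \<subseteq> insert l (set w)"
  by (cases w) auto

lemma reduced_foldr: "reduced w \<Longrightarrow> reduced (foldr prefix_letter u w)"
  by (induction u) (auto intro: reduced_prefix_letter)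

lemma set_foldr_prefix_letter: "set (foldr prefix_letter u w) \<subseteq> set u \<union> set w"
proof (induction u)
  case (Cons l u)
  then show ?case using set_prefix_letter[of l "foldr prefix_letter u w"] by auto
qed simp

lemma foldr_prefix_letter_Nil: "reduced w \<Longrightarrow> foldr prefix_letter w [] = w"
  by (induction w) (use reduced_ConsD prefix_letter_Cons in \<open>fastforce+\<close>)

lemma foldr_prefix_letter_step:
  assumes "reduced w"
  shows "foldr prefix_letter (prefix_letter l u) w = prefix_letter l (foldr prefix_letter u w)"
proof (cases u)
  case (Cons k u')
  show ?thesis
  proof (cases "k = inv_letter l")
    case True
    then show ?thesis
      using Cons prefix_letter_inverse[OF reduced_foldr[OF assms], of l u'] by simp
  qed (use Cons in auto)
qed simp

lemma foldr_prefix_letter_assoc: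
  "reduced w \<Longrightarrow> foldr prefix_letter (foldr prefix_letter t u) w =
     foldr prefix_letter t (foldr prefix_letter u w)"
  by (induction t) (auto simp: foldr_prefix_letter_step)

lemma foldr_prefix_letter_inverse:
  "reduced w \<Longrightarrow> foldr prefix_letter (rev (map inv_letter u)) (foldr prefix_letter u w) = w"
proof (induction u arbitrary: w)
  case (Cons l u)
  then show ?case
    using prefix_letter_inverse[OF reduced_foldr[OF Cons.prems], of "inv_letter l" u] by simp
qed simp

lemma group_free_group: "group (free_group X)"
proof (rule groupI)
  fix x y assume "x \<in> carrier (free_group X)" "y \<in> carrier (free_group X)"
  then show "x \<otimes>\<^bsub>free_group X\<^esub> y \<in> carrier (free_group X)"
    using set_foldr_prefix_letter[of x y]
    by (fastforce simp: free_group_def intro: reduced_foldr)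
next
  fix x assume x: "x \<in> carrier (free_group X)"
  let ?v = "foldr prefix_letter (rev (map inv_letter x)) []"
  have "?v \<in> carrier (free_group X)"
  proof -
    have "fst ` set ?v \<subseteq> fst ` set (rev (map inv_letter x))"
      using set_foldr_prefix_letter[of "rev (map inv_letter x)" "[]"] by (intro image_mono) simp
    also have "\<dots> \<subseteq> X" using x by (auto simp: free_group_def)
    finally show ?thesis by (simp add: free_group_def reduced_foldr)
  qed
  moreover have "?v \<otimes>\<^bsub>free_group X\<^esub> x = \<one>\<^bsub>free_group X\<^esub>"
    using x foldr_prefix_letter_inverse[of "[]" x]
    by (simp add: free_group_def foldr_prefix_letter_assoc foldr_prefix_letter_Nil)
  ultimately show "\<exists>y\<in>carrier (free_group X). y \<otimes>\<^bsub>free_group X\<^esub> x = \<one>\<^bsub>free_group X\<^esub>" by blast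
qed (auto simp: free_group_def foldr_prefix_letter_assoc)

definition free_gen :: "'x \<Rightarrow> ('x \<times> bool) list" where
  "free_gen x = [(x, True)]"


section \<open>Group graded rings without unit\<close>

text \<open>We use the record types of \<open>HOL-Algebra\<close>; the field \<open>one\<close> of a ring is ignored.\<close>

locale nonunital_ring = abelian_group T for T (structure) +
  assumes mult_closed: "x \<in> carrier T \<Longrightarrow> y \<in> carrier T \<Longrightarrow> x \<otimes> y \<in> carrier T"
    and mult_assoc: "x \<in> carrier T \<Longrightarrow> y \<in> carrier T \<Longrightarrow> z \<in> carrier T \<Longrightarrow>
      (x \<otimes> y) \<otimes> z = x \<otimes> (y \<otimes> z)"
    and left_distrib: "x \<in> carrier T \<Longrightarrow> y \<in> carrier T \<Longrightarrow> z \<in> carrier T \<Longrightarrow>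
      (x \<oplus> y) \<otimes> z = x \<otimes> z \<oplus> y \<otimes> z"
    and right_distrib: "x \<in> carrier T \<Longrightarrow> y \<in> carrier T \<Longrightarrow> z \<in> carrier T \<Longrightarrow>
      z \<otimes> (x \<oplus> y) = z \<otimes> x \<oplus> z \<otimes> y"

definition sums_of_products :: "('t, 'm) ring_scheme \<Rightarrow> 't set \<Rightarrow> 't set \<Rightarrow> 't set" where
  "sums_of_products T A B =
     {\<Oplus>\<^bsub>T\<^esub>i\<in>{..<n}. a i \<otimes>\<^bsub>T\<^esub> b i | (n :: nat) a b. \<forall>i<n. a i \<in> A \<and> b i \<in> B}"

locale group_graded_ring = nonunital_ring T + group \<Gamma>
  for T :: "('t, 'm) ring_scheme" (structure) and \<Gamma> :: "('g, 'n) monoid_scheme" (structure) +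
  fixes S :: "'g \<Rightarrow> 't set"
  assumes component: "g \<in> carrier \<Gamma> \<Longrightarrow> additive_subgroup (S g) T"
    and direct_sum: "x \<in> carrier T \<Longrightarrow>
      \<exists>!f. f \<in> (\<Pi>\<^sub>E g\<in>carrier \<Gamma>. S g) \<and> finite {g \<in> carrier \<Gamma>. f g \<noteq> \<zero>\<^bsub>T\<^esub>} \<and>
           x = (\<Oplus>\<^bsub>T\<^esub>g\<in>{g \<in> carrier \<Gamma>. f g \<noteq> \<zero>\<^bsub>T\<^esub>}. f g)"
    and component_mult: "g \<in> carrier \<Gamma> \<Longrightarrow> h \<in> carrier \<Gamma> \<Longrightarrow>
      sums_of_products T (S g) (S h) \<subseteq> S (g \<otimes>\<^bsub>\<Gamma>\<^esub> h)"

locale epsilon_strongly_graded_ring = group_graded_ring +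
  assumes epsilon: "\<exists>\<epsilon>. \<forall>g\<in>carrier \<Gamma>.
      \<epsilon> g \<in> sums_of_products T (S g) (S (inv\<^bsub>\<Gamma>\<^esub> g)) \<and>
      (\<forall>s\<in>S g. \<epsilon> g \<otimes>\<^bsub>T\<^esub> s = s \<and> s \<otimes>\<^bsub>T\<^esub> \<epsilon> (inv\<^bsub>\<Gamma>\<^esub> g) = s)"


section \<open>The Leavitt path algebra of an ultragraph\<close>

datatype 'a free_monoid = Word (letters: "'a list")

instantiation free_monoid :: (type) monoid_add
begin

definition "0 = Word []"

definition "u + w = Word (letters u @ letters w)"

instance
  by standard (auto simp: zero_free_monoid_def plus_free_monoid_def)

end

datatype ('v, 'e) lpa_gen = GenP "'v set" | GenS 'e | GenSstar 'e

text \<open>The free unital algebra over \<open>'r\<close> on all symbols is the monoid algebra of the free monoid.\<close>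

type_synonym ('v, 'e, 'r) free_alg = "('v, 'e) lpa_gen free_monoid \<Rightarrow>\<^sub>0 'r"

definition lpa_gens :: "('v, 'e) ultragraph \<Rightarrow> ('v, 'e) lpa_gen set" where
  "lpa_gens G = GenP ` gen_verts G \<union> GenS ` edges G \<union> GenSstar ` edges G"

text \<open>The free algebra without unit on the generators: only non-empty words occur.\<close>

definition free_alg :: "('v, 'e) ultragraph \<Rightarrow> ('v, 'e, 'r::comm_ring_1) free_alg set" where
  "free_alg G = {x. \<forall>w\<in>Poly_Mapping.keys x. letters w \<noteq> [] \<and> set (letters w) \<subseteq> lpa_gens G}"

definition scale :: "'r \<Rightarrow> ('v, 'e, 'r) free_alg \<Rightarrow> ('v, 'e, 'r::comm_ring_1) free_alg" where
  "scale c x = Poly_Mapping.single 0 c * x"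

definition P :: "'v set \<Rightarrow> ('v, 'e, 'r::comm_ring_1) free_alg" where
  "P A = Poly_Mapping.single (Word [GenP A]) 1"

definition S :: "'e \<Rightarrow> ('v, 'e, 'r::comm_ring_1) free_alg" where
  "S e = Poly_Mapping.single (Word [GenS e]) 1"

definition Sstar :: "'e \<Rightarrow> ('v, 'e, 'r::comm_ring_1) free_alg" where
  "Sstar e = Poly_Mapping.single (Word [GenSstar e]) 1"

text \<open>A relation \<open>x = y\<close> is represented by the element \<open>x - y\<close>.\<close>

inductive_set lpa_relators :: "('v, 'e) ultragraph \<Rightarrow> ('v, 'e, 'r::comm_ring_1) free_alg set"
  for G :: "('v, 'e) ultragraph" where
  P_empty: "P {} \<in> lpa_relators G"
| P_inter: "A \<in> gen_verts G \<Longrightarrow> B \<in> gen_verts G \<Longrightarrow> P A * P B - P (A \<inter> B) \<in> lpa_relators G"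
| P_union: "A \<in> gen_verts G \<Longrightarrow> B \<in> gen_verts G \<Longrightarrow>
    P (A \<union> B) - (P A + P B - P (A \<inter> B)) \<in> lpa_relators G"
| src_S: "e \<in> edges G \<Longrightarrow> P {src G e} * S e - S e \<in> lpa_relators G"
| S_rng: "e \<in> edges G \<Longrightarrow> S e * P (rng G e) - S e \<in> lpa_relators G"
| rng_Sstar: "e \<in> edges G \<Longrightarrow> P (rng G e) * Sstar e - Sstar e \<in> lpa_relators G"
| Sstar_src: "e \<in> edges G \<Longrightarrow> Sstar e * P {src G e} - Sstar e \<in> lpa_relators G"
| Sstar_S: "e \<in> edges G \<Longrightarrow> f \<in> edges G \<Longrightarrow>
    Sstar e * S f - (if e = f then P (rng G e) else 0) \<in> lpa_relators G"
| regular_vertex: "v \<in> verts G \<Longrightarrow> {e \<in> edges G. src G e = v} \<noteq> {} \<Longrightarrow>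
    finite {e \<in> edges G. src G e = v} \<Longrightarrow>
    P {v} - (\<Sum>e\<in>{e \<in> edges G. src G e = v}. S e * Sstar e) \<in> lpa_relators G"

inductive_set lpa_ideal :: "('v, 'e) ultragraph \<Rightarrow> ('v, 'e, 'r::comm_ring_1) free_alg set"
  for G :: "('v, 'e) ultragraph" where
  zero: "0 \<in> lpa_ideal G"
| relator: "x \<in> lpa_relators G \<Longrightarrow> x \<in> lpa_ideal G"
| add: "x \<in> lpa_ideal G \<Longrightarrow> y \<in> lpa_ideal G \<Longrightarrow> x + y \<in> lpa_ideal G"
| scale: "x \<in> lpa_ideal G \<Longrightarrow> scale c x \<in> lpa_ideal G"
| mult_left: "a \<in> free_alg G \<Longrightarrow> x \<in> lpa_ideal G \<Longrightarrow> a * x \<in> lpa_ideal G"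
| mult_right: "a \<in> free_alg G \<Longrightarrow> x \<in> lpa_ideal G \<Longrightarrow> x * a \<in> lpa_ideal G"

definition lpa_class ::
    "('v, 'e) ultragraph \<Rightarrow> ('v, 'e, 'r) free_alg \<Rightarrow> ('v, 'e, 'r::comm_ring_1) free_alg set" where
  "lpa_class G x = {y \<in> free_alg G. y - x \<in> lpa_ideal G}"

text \<open>The quotient of the free algebra without unit by the ideal generated by the relators. In
  general this algebra has no unit, so the field \<open>one\<close> carries no meaning.\<close>

definition leavitt_path_algebra ::
    "('v, 'e) ultragraph \<Rightarrow> ('r::comm_ring_1, ('v, 'e, 'r) free_alg set) module" where
  "leavitt_path_algebra G = \<lparr>carrier = lpa_class G ` free_alg G,
     mult = (\<lambda>X Y. \<Union>x\<in>X. \<Union>y\<in>Y. lpa_class G (x * y)),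
     one = undefined,
     zero = lpa_class G 0,
     add = (\<lambda>X Y. \<Union>x\<in>X. \<Union>y\<in>Y. lpa_class G (x + y)),
     smult = (\<lambda>c X. \<Union>x\<in>X. lpa_class G (scale c x))\<rparr>"


text \<open>The operations do not depend on representatives, and the quotient is a ring.\<close>

lemma free_alg_zero: "0 \<in> free_alg G"
  by (simp add: free_alg_def)

lemma free_alg_add: "x \<in> free_alg G \<Longrightarrow> y \<in> free_alg G \<Longrightarrow> x + y \<in> free_alg G"
  unfolding free_alg_def using Poly_Mapping.keys_add[of x y] by blast

lemma free_alg_mult:
  assumes "x \<in> free_alg G" "y \<in> free_alg G"
  shows "x * y \<in> free_alg G"
proof -
  have "letters (u + w) \<noteq> [] \<and> set (letters (u + w)) \<subseteq> lpa_gens G"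
    if "u \<in> Poly_Mapping.keys x" "w \<in> Poly_Mapping.keys y" for u w
    using assms that by (auto simp: free_alg_def plus_free_monoid_def)
  then show ?thesis unfolding free_alg_def using keys_mult[of x y] by blast
qed

lemma free_alg_scale: "x \<in> free_alg G \<Longrightarrow> scale c x \<in> free_alg G"
  unfolding free_alg_def scale_def
  using keys_mult[of "Poly_Mapping.single 0 c" x] by (fastforce split: if_splits)

lemma scale_minus_one: "scale (- 1) x = - x"
  unfolding scale_def single_uminus by simp

lemma free_alg_uminus: "x \<in> free_alg G \<Longrightarrow> - x \<in> free_alg G"
  by (simp add: free_alg_def)

lemma free_alg_diff: "x \<in> free_alg G \<Longrightarrow> y \<in> free_alg G \<Longrightarrow> x - y \<in> free_alg G"
  using free_alg_add[of x G "- y"] by (simp add: free_alg_uminus)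

lemma free_alg_gens:
  "A \<in> gen_verts G \<Longrightarrow> P A \<in> free_alg G"
  "e \<in> edges G \<Longrightarrow> S e \<in> free_alg G"
  "e \<in> edges G \<Longrightarrow> Sstar e \<in> free_alg G"
  by (auto simp: free_alg_def P_def S_def Sstar_def lpa_gens_def)

lemma free_alg_sum: "(\<And>i. i \<in> I \<Longrightarrow> f i \<in> free_alg G) \<Longrightarrow> sum f I \<in> free_alg G"
  by (induction I rule: infinite_finite_induct) (auto intro: free_alg_zero free_alg_add)

context ultragraph
begin

lemma relators_free_alg: "x \<in> lpa_relators G \<Longrightarrow> x \<in> free_alg G"
  by (induction rule: lpa_relators.induct)
    (auto intro!: free_alg_diff free_alg_add free_alg_mult free_alg_gens free_alg_sum free_alg_zero
       gen_verts.intros src_closed)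

lemma ideal_free_alg: "x \<in> lpa_ideal G \<Longrightarrow> x \<in> free_alg G"
  by (induction rule: lpa_ideal.induct)
    (auto intro: free_alg_zero free_alg_add free_alg_mult free_alg_scale relators_free_alg)

lemma ideal_uminus: "x \<in> lpa_ideal G \<Longrightarrow> - x \<in> lpa_ideal G"
  using lpa_ideal.scale[of x G "- 1"] by (simp add: scale_minus_one)

lemma ideal_diff: "x \<in> lpa_ideal G \<Longrightarrow> y \<in> lpa_ideal G \<Longrightarrow> x - y \<in> lpa_ideal G"
  using lpa_ideal.add[of x G "- y"] by (simp add: ideal_uminus)

lemma class_self: "x \<in> free_alg G \<Longrightarrow> x \<in> lpa_class G x"
  by (simp add: lpa_class_def lpa_ideal.zero)

lemma class_eq_iff:
  assumes "x \<in> free_alg G"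
  shows "lpa_class G x = lpa_class G y \<longleftrightarrow> x - y \<in> lpa_ideal G"
proof
  assume "lpa_class G x = lpa_class G y"
  then show "x - y \<in> lpa_ideal G" using class_self[OF assms] by (auto simp: lpa_class_def)
next
  assume d: "x - y \<in> lpa_ideal G"
  have "z - x \<in> lpa_ideal G \<longleftrightarrow> z - y \<in> lpa_ideal G" for z
    using lpa_ideal.add[of "z - x" G "x - y"] ideal_diff[of "z - y" "x - y"] d by auto
  then show "lpa_class G x = lpa_class G y" by (auto simp: lpa_class_def)
qed

lemma class_mult:
  assumes "x \<in> free_alg G" "y \<in> free_alg G"
  shows "lpa_class G x \<otimes>\<^bsub>leavitt_path_algebra G\<^esub> lpa_class G y = lpa_class G (x * y)"
proof -
  have "lpa_class G (x' * y') = lpa_class G (x * y)"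
    if "x' \<in> lpa_class G x" "y' \<in> lpa_class G y" for x' y'
  proof -
    have "x' * y' - x * y = (x' - x) * y' + x * (y' - y)" by (simp add: algebra_simps)
    also have "\<dots> \<in> lpa_ideal G"
      using that assms lpa_ideal.mult_right[of y' G "x' - x"] lpa_ideal.mult_left[of x G "y' - y"]
      by (auto simp: lpa_class_def intro: lpa_ideal.add)
    finally show ?thesis
      using that by (subst class_eq_iff) (auto simp: lpa_class_def intro: free_alg_mult)
  qed
  moreover have "lpa_class G x \<noteq> {}" "lpa_class G y \<noteq> {}" using class_self assms by auto
  ultimately show ?thesis by (simp add: leavitt_path_algebra_def)
qed

lemma class_add:
  assumes "x \<in> free_alg G" "y \<in> free_alg G"
  shows "lpa_class G x \<oplus>\<^bsub>leavitt_path_algebra G\<^esub> lpa_class G y = lpa_class G (x + y)"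
proof -
  have "lpa_class G (x' + y') = lpa_class G (x + y)"
    if "x' \<in> lpa_class G x" "y' \<in> lpa_class G y" for x' y'
  proof -
    have "x' + y' - (x + y) = (x' - x) + (y' - y)" by (simp add: algebra_simps)
    also have "\<dots> \<in> lpa_ideal G"
      using that assms by (auto simp: lpa_class_def intro!: lpa_ideal.add)
    finally show ?thesis
      using that by (subst class_eq_iff) (auto simp: lpa_class_def intro: free_alg_add)
  qed
  moreover have "lpa_class G x \<noteq> {}" "lpa_class G y \<noteq> {}" using class_self assms by auto
  ultimately show ?thesis by (simp add: leavitt_path_algebra_def)
qed

lemma scale_diff: "scale c (x - y) = scale c x - scale c y"
  by (simp add: scale_def algebra_simps)

lemma class_scale:
  assumes "x \<in> free_alg G"
  shows "c \<odot>\<^bsub>leavitt_path_algebra G\<^esub> lpa_class G x = lpa_class G (scale c x)"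
proof -
  have "lpa_class G (scale c x') = lpa_class G (scale c x)" if "x' \<in> lpa_class G x" for x'
    using that lpa_ideal.scale[of "x' - x" G c]
    by (subst class_eq_iff) (auto simp: lpa_class_def scale_diff intro: free_alg_scale)
  moreover have "lpa_class G x \<noteq> {}" using class_self assms by auto
  ultimately show ?thesis by (simp add: leavitt_path_algebra_def)
qed

lemma carrier_lpa: "carrier (leavitt_path_algebra G) = lpa_class G ` free_alg G"
  by (simp add: leavitt_path_algebra_def)

lemma zero_lpa: "\<zero>\<^bsub>leavitt_path_algebra G\<^esub> = lpa_class G 0"
  by (simp add: leavitt_path_algebra_def)

lemma nonunital_ring_lpa:
  "nonunital_ring (leavitt_path_algebra G :: ('r::comm_ring_1, (_, _, 'r) free_alg set) module)"
proof (intro nonunital_ring.intro nonunital_ring_axioms.intro abelian_groupI)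
  fix X assume "X \<in> carrier (leavitt_path_algebra G :: ('r, (_, _, 'r) free_alg set) module)"
  then obtain x where x: "x \<in> free_alg G" "X = lpa_class G x" by (auto simp: carrier_lpa)
  then have "lpa_class G (- x) \<oplus>\<^bsub>leavitt_path_algebra G\<^esub> X = \<zero>\<^bsub>leavitt_path_algebra G\<^esub>"
    by (simp add: class_add free_alg_uminus zero_lpa)
  with x show "\<exists>Y\<in>carrier (leavitt_path_algebra G).
      Y \<oplus>\<^bsub>leavitt_path_algebra G\<^esub> X = \<zero>\<^bsub>leavitt_path_algebra G\<^esub>"
    by (auto simp: carrier_lpa free_alg_uminus)
qed (auto simp: carrier_lpa class_add class_mult zero_lpa free_alg_add free_alg_mult free_alg_zero
  algebra_simps)

end


section \<open>The grading by the free group on the edges\<close>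

fun nonempty_prod :: "('a, 'm) monoid_scheme \<Rightarrow> 'a list \<Rightarrow> 'a" where
  "nonempty_prod M [] = undefined"
| "nonempty_prod M [x] = x"
| "nonempty_prod M (x # y # xs) = x \<otimes>\<^bsub>M\<^esub> nonempty_prod M (y # xs)"

fun path_elem :: "('v, 'e) ultragraph \<Rightarrow> ('v, 'e) fpath \<Rightarrow> ('v, 'e, 'r::comm_ring_1) free_alg set"
  where
  "path_elem G (GenVertex A) = lpa_class G (P A)"
| "path_elem G (EdgePath es) =
     nonempty_prod (leavitt_path_algebra G) (map (\<lambda>e. lpa_class G (S e)) es)"

fun path_elem_star ::
    "('v, 'e) ultragraph \<Rightarrow> ('v, 'e) fpath \<Rightarrow> ('v, 'e, 'r::comm_ring_1) free_alg set" where
  "path_elem_star G (GenVertex A) = lpa_class G (P A)"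
| "path_elem_star G (EdgePath es) =
     nonempty_prod (leavitt_path_algebra G) (map (\<lambda>e. lpa_class G (Sstar e)) (rev es))"

fun path_degree :: "('v, 'e) ultragraph \<Rightarrow> ('v, 'e) fpath \<Rightarrow> ('e \<times> bool) list" where
  "path_degree G (GenVertex A) = \<one>\<^bsub>free_group (edges G)\<^esub>"
| "path_degree G (EdgePath es) =
     foldr (\<lambda>e w. free_gen e \<otimes>\<^bsub>free_group (edges G)\<^esub> w) es \<one>\<^bsub>free_group (edges G)\<^esub>"

definition linear_span :: "('r, 'b, 'm) module_scheme \<Rightarrow> 'b set \<Rightarrow> 'b set" where
  "linear_span M X =
     {\<Oplus>\<^bsub>M\<^esub>i\<in>{..<n}. c i \<odot>\<^bsub>M\<^esub> x i | (n :: nat) c x. \<forall>i<n. x i \<in> X}"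

definition lpa_component ::
    "('v, 'e) ultragraph \<Rightarrow> ('e \<times> bool) list \<Rightarrow> ('v, 'e, 'r::comm_ring_1) free_alg set set" where
  "lpa_component G t = linear_span (leavitt_path_algebra G)
     {path_elem G \<alpha> \<otimes>\<^bsub>leavitt_path_algebra G\<^esub> lpa_class G (P A)
        \<otimes>\<^bsub>leavitt_path_algebra G\<^esub> path_elem_star G \<beta> | \<alpha> A \<beta>.
        is_fpath G \<alpha> \<and> is_fpath G \<beta> \<and> A \<in> gen_verts G \<and>
        path_degree G \<alpha> \<otimes>\<^bsub>free_group (edges G)\<^esub> inv\<^bsub>free_group (edges G)\<^esub> path_degree G \<beta> = t}"

end

theory Submission
  imports Defs
begin

text \<open>The relations are homogeneous, so the ideal they generate is graded, and rewriting a word with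
  the relations shows that it is zero or a word \<open>s\<^sub>\<alpha> p\<^sub>A s\<^sub>\<beta>\<^sup>*\<close> of the same degree; hence the components are
  the images of the homogeneous elements of the free algebra, and their sum is direct.

  If \<open>G\<^sup>0\<close> is a generalized vertex and \<open>\<alpha>\<beta>\<inverse>\<close> is reduced, then each spanning element of that degree
  has the form \<open>s\<^sub>\<alpha> (s\<^sub>\<gamma> p\<^sub>A s\<^sub>\<gamma>\<^sup>*) s\<^sub>\<beta>\<^sup>*\<close>, so that \<open>s\<^sub>\<alpha> p s\<^sub>\<alpha>\<^sup>*\<close>, where \<open>p\<close> is the projection of \<open>r(\<beta>)\<close>, is a left unit
  of the component and a right unit of the opposite one; it factors as
  \<open>(s\<^sub>\<alpha> p s\<^sub>\<beta>\<^sup>*)(s\<^sub>\<beta> p s\<^sub>\<alpha>\<^sup>*)\<close>. Components of all other degrees vanish.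

  Conversely, a left unit of the neutral component is a finite combination of words, so it kills \<open>p\<^sub>v\<close>
  for all \<open>v\<close> outside some generalized vertex. As \<open>p\<^sub>v\<close> is never zero, which is seen in the
  representation on functions on boundary paths, there is no such \<open>v\<close>.\<close>

section \<open>Linear extension from words to the free algebra\<close>

text \<open>Computations take place on representatives in the free algebra, modulo
  \<open>lpa_ideal G\<close>; classes and the operations of the quotient enter only for the grading
  and the final statements. No uniqueness of normal forms is involved: every word has one of its own
  degree, and the only nonvanishing statement concerns vertex projections. A local unit depends on
  the degree alone because the ambient group is free: cancelling the longest common suffix \<gamma>
  of two paths leaves a pair whose word is reduced, so the degree determines \<alpha> and \<beta>,
  while \<gamma> and \<open>A\<close> vary. The obstacle is the empty path: its range projection has
  to be the projection of the whole vertex set, which is available exactly when that set is a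
  generalized vertex. In the converse direction, closure of generalized vertices under finite unions
  turns the finitely many words of a unit into one set outside which it kills all vertices.\<close>

definition monomial :: "('v, 'e) lpa_gen list \<Rightarrow> ('v, 'e, 'r::comm_ring_1) free_alg" where
  "monomial w = Poly_Mapping.single (Word w) 1"

lemma monomial_mult: "monomial u * monomial w = monomial (u @ w)"
  by (simp add: monomial_def mult_single plus_free_monoid_def)

lemma gens_monomial:
  "P A = monomial [GenP A]" "S e = monomial [GenS e]" "Sstar e = monomial [GenSstar e]"
  by (simp_all add: monomial_def P_def S_def Sstar_def)

lemma monomial_free_alg: "w \<noteq> [] \<Longrightarrow> set w \<subseteq> lpa_gens G \<Longrightarrow> monomial w \<in> free_alg G"
  by (simp add: monomial_def free_alg_def)

lemma single_conv_scale_monomial: "Poly_Mapping.single w c = scale c (monomial (letters w))"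
  by (simp add: scale_def monomial_def mult_single)

lemma sum_single_keys:
  fixes x :: "'w \<Rightarrow>\<^sub>0 'r::comm_monoid_add"
  shows "(\<Sum>w\<in>Poly_Mapping.keys x. Poly_Mapping.single w (Poly_Mapping.lookup x w)) = x"
proof (rule poly_mapping_eqI)
  fix k
  show "Poly_Mapping.lookup (\<Sum>w\<in>Poly_Mapping.keys x. Poly_Mapping.single w
      (Poly_Mapping.lookup x w)) k = Poly_Mapping.lookup x k"
    by (cases "k \<in> Poly_Mapping.keys x")
      (simp_all add: lookup_sum lookup_single when_def not_in_keys_iff_lookup_eq_zero)
qed

text \<open>The single-word case is demanded only for keys of \<open>x\<close>, so that membership
  of \<open>x\<close> in \<open>free_alg G\<close> or \<open>homogeneous G t\<close> still controls
  the words met in the induction.\<close>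

lemma poly_mapping_single_induct [case_names zero single add]:
  fixes x :: "'w \<Rightarrow>\<^sub>0 'r::comm_monoid_add"
  assumes "Q 0" "\<And>w c. w \<in> Poly_Mapping.keys x \<Longrightarrow> Q (Poly_Mapping.single w c)"
    and "\<And>a b. Q a \<Longrightarrow> Q b \<Longrightarrow> Q (a + b)"
  shows "Q x"
proof -
  have "Q (\<Sum>w\<in>K. Poly_Mapping.single w (Poly_Mapping.lookup x w))"
    if "finite K" "K \<subseteq> Poly_Mapping.keys x" for K
    using that by (induction K) (auto simp: assms)
  from this[of "Poly_Mapping.keys x"] show ?thesis by (simp add: sum_single_keys)
qed

definition lin_ext :: "('w \<Rightarrow> 'r::comm_ring_1) \<Rightarrow> ('w \<Rightarrow>\<^sub>0 'r) \<Rightarrow> 'r" where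
  "lin_ext \<phi> x = (\<Sum>w\<in>Poly_Mapping.keys x. Poly_Mapping.lookup x w * \<phi> w)"

lemma lin_ext_superset:
  assumes "finite K" "Poly_Mapping.keys x \<subseteq> K"
  shows "lin_ext \<phi> x = (\<Sum>w\<in>K. Poly_Mapping.lookup x w * \<phi> w)"
  unfolding lin_ext_def
  using assms by (intro sum.mono_neutral_left) (auto simp: not_in_keys_iff_lookup_eq_zero)

lemma lin_ext_add: "lin_ext \<phi> (x + y) = lin_ext \<phi> x + lin_ext \<phi> y"
  by (subst (1 2 3) lin_ext_superset[of "Poly_Mapping.keys x \<union> Poly_Mapping.keys y"])
    (use Poly_Mapping.keys_add[of x y] in \<open>auto simp: lookup_add distrib_right sum.distrib\<close>)

lemma lin_ext_single [simp]: "lin_ext \<phi> (Poly_Mapping.single w c) = c * \<phi> w"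
  by (simp add: lin_ext_def)

lemma lin_ext_zero [simp]: "lin_ext \<phi> 0 = 0"
  by (simp add: lin_ext_def)

lemma lin_ext_diff: "lin_ext \<phi> (x - y) = lin_ext \<phi> x - lin_ext \<phi> y"
  using lin_ext_add[of \<phi> "x - y" y] by simp

lemma lin_ext_sum: "lin_ext \<phi> (sum f I) = (\<Sum>i\<in>I. lin_ext \<phi> (f i))"
  by (induction I rule: infinite_finite_induct) (auto simp: lin_ext_add)

section \<open>Vertices are nonzero in the Leavitt path algebra\<close>

text \<open>The algebra is represented on functions on the boundary paths of the ultragraph. A boundary
  path is encoded by its sequence of vertices together with the next edge; \<open>None\<close> ends the path,
  and the entries after it carry no meaning.\<close>

type_synonym ('v, 'e) path_seq = "nat \<Rightarrow> 'v \<times> 'e option"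

definition regular :: "('v, 'e) ultragraph \<Rightarrow> 'v \<Rightarrow> bool" where
  "regular G v \<longleftrightarrow> {e \<in> edges G. src G e = v} \<noteq> {} \<and> finite {e \<in> edges G. src G e = v}"

text \<open>A path may stop only at a vertex that emits no edge or infinitely many; this is what
  makes the relation at regular vertices hold. The condition is imposed at every index, also after
  the first \<open>None\<close>, so that deleting the first entry preserves it without case
  distinction.\<close>

definition boundary_paths :: "('v, 'e) ultragraph \<Rightarrow> ('v, 'e) path_seq set" where
  "boundary_paths G = {x. \<forall>i. case snd (x i) of
     Some e \<Rightarrow> e \<in> edges G \<and> src G e = fst (x i) \<and> fst (x (Suc i)) \<in> rng G e
   | None \<Rightarrow> \<not> regular G (fst (x i))}"

text \<open>On boundary paths, \<open>GenS e\<close> sends the indicator of \<open>y\<close> to that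
  of \<open>e\<close> followed by \<open>y\<close>, or to 0 if this is not a path;
  \<open>GenSstar e\<close> is the opposite shift. All functions are allowed, not only those of
  finite support, so the constant function 1 can serve as a test vector.\<close>

fun gen_act :: "('v, 'e) ultragraph \<Rightarrow> ('v, 'e) lpa_gen \<Rightarrow> (('v, 'e) path_seq \<Rightarrow> 'r::comm_ring_1) \<Rightarrow>
    ('v, 'e) path_seq \<Rightarrow> 'r" where
  "gen_act G (GenP A) f x = (if fst (x 0) \<in> A then f x else 0)"
| "gen_act G (GenS e) f x = (if snd (x 0) = Some e then f (\<lambda>i. x (Suc i)) else 0)"
| "gen_act G (GenSstar e) f x =
     (if fst (x 0) \<in> rng G e then f (case_nat (src G e, Some e) x) else 0)"

definition word_act :: "('v, 'e) ultragraph \<Rightarrow> ('v, 'e) lpa_gen list \<Rightarrow>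
    (('v, 'e) path_seq \<Rightarrow> 'r::comm_ring_1) \<Rightarrow> ('v, 'e) path_seq \<Rightarrow> 'r" where
  "word_act G w f = foldr (gen_act G) w f"

definition alg_act :: "('v, 'e) ultragraph \<Rightarrow> ('v, 'e, 'r) free_alg \<Rightarrow>
    (('v, 'e) path_seq \<Rightarrow> 'r::comm_ring_1) \<Rightarrow> ('v, 'e) path_seq \<Rightarrow> 'r" where
  "alg_act G a f x = lin_ext (\<lambda>w. word_act G (letters w) f x) a"

lemma word_act_simps [simp]:
  "word_act G [] f = f" "word_act G (g # w) f = gen_act G g (word_act G w f)"
  by (simp_all add: word_act_def)

lemma word_act_append: "word_act G (u @ w) f = word_act G u (word_act G w f)"
  by (simp add: word_act_def)

lemma word_act_add:
  "word_act G w (\<lambda>x. f x + f' x) = (\<lambda>x. word_act G w f x + word_act G w f' x)"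
proof (induction w)
  case (Cons g w)
  then show ?case by (cases g) (auto simp: fun_eq_iff)
qed simp

lemma word_act_scale: "word_act G w (\<lambda>x. c * f x) = (\<lambda>x. c * word_act G w f x)"
proof (induction w)
  case (Cons g w)
  then show ?case by (cases g) (auto simp: fun_eq_iff)
qed simp

lemma alg_act_simps [simp]:
  "alg_act G 0 f = (\<lambda>x. 0)"
  "alg_act G (a + b) f = (\<lambda>x. alg_act G a f x + alg_act G b f x)"
  "alg_act G (a - b) f = (\<lambda>x. alg_act G a f x - alg_act G b f x)"
  "alg_act G (sum h I) f = (\<lambda>x. \<Sum>i\<in>I. alg_act G (h i) f x)"
  "alg_act G (Poly_Mapping.single w c) f = (\<lambda>x. c * word_act G (letters w) f x)"
  "alg_act G (monomial u) f = word_act G u f"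
  by (auto simp: alg_act_def fun_eq_iff lin_ext_add lin_ext_diff lin_ext_sum monomial_def)

lemma alg_act_fun_add:
  "alg_act G a (\<lambda>x. f x + f' x) = (\<lambda>x. alg_act G a f x + alg_act G a f' x)"
  by (auto simp: alg_act_def fun_eq_iff lin_ext_def word_act_add algebra_simps sum.distrib)

lemma alg_act_mult: "alg_act G (a * b) f = alg_act G a (alg_act G b f)"
proof (induction a rule: poly_mapping_single_induct)
  case (single u c)
  show ?case
  proof (induction b rule: poly_mapping_single_induct)
    case (single w d)
    show ?case
      by (simp add: mult_single plus_free_monoid_def word_act_append word_act_scale mult.assoc)
  next
    case (add b b')
    then show ?case by (simp add: ring_distribs alg_act_fun_add word_act_add)
  qed (simp add: word_act_scale[of G _ 0, simplified])
next
  case (add a a')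
  then show ?case by (simp add: ring_distribs)
qed simp

context ultragraph
begin

text \<open>The relations hold only when evaluated at boundary paths, whereas the operators act on
  functions on all sequences. Functions vanishing on boundary paths form a stable submodule, so they
  may be neglected: removing the first edge of a boundary path, or prepending an edge whose range
  contains its first vertex, gives a boundary path again.\<close>

lemma gen_act_vanishes:
  assumes "g \<in> lpa_gens G" "\<forall>x\<in>boundary_paths G. f x = 0" "x \<in> boundary_paths G"
  shows "gen_act G g f x = 0"
proof (cases g)
  case (GenS e)
  have "(\<lambda>i. x (Suc i)) \<in> boundary_paths G"
    using assms(3) by (simp add: boundary_paths_def)
  with GenS assms(2) show ?thesis by auto
next
  case (GenSstar e)
  have "case_nat (src G e, Some e) x \<in> boundary_paths G" if "fst (x 0) \<in> rng G e"
    using assms that GenSstar by (auto simp: boundary_paths_def lpa_gens_def split: nat.split)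
  with GenSstar assms(2) show ?thesis by auto
qed (use assms in auto)

lemma word_act_vanishes:
  "set w \<subseteq> lpa_gens G \<Longrightarrow> \<forall>x\<in>boundary_paths G. f x = 0 \<Longrightarrow>
    \<forall>x\<in>boundary_paths G. word_act G w f x = 0"
  by (induction w) (auto intro: gen_act_vanishes)

lemma alg_act_vanishes:
  assumes "a \<in> free_alg G" "\<forall>x\<in>boundary_paths G. f x = 0" "x \<in> boundary_paths G"
  shows "alg_act G a f x = 0"
  unfolding alg_act_def lin_ext_def
proof (rule sum.neutral, rule ballI)
  fix w assume "w \<in> Poly_Mapping.keys a"
  then have "set (letters w) \<subseteq> lpa_gens G" using assms(1) by (auto simp: free_alg_def)
  with word_act_vanishes assms(2,3) have "word_act G (letters w) f x = 0" by blast
  then show "Poly_Mapping.lookup a w * word_act G (letters w) f x = 0" by simp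
qed

lemma boundary_pathD:
  assumes "x \<in> boundary_paths G"
  shows "snd (x i) = Some e \<Longrightarrow> e \<in> edges G \<and> src G e = fst (x i) \<and> fst (x (Suc i)) \<in> rng G e"
    "snd (x i) = None \<Longrightarrow> \<not> regular G (fst (x i))"
proof -
  have *: "case snd (x i) of
     Some e \<Rightarrow> e \<in> edges G \<and> src G e = fst (x i) \<and> fst (x (Suc i)) \<in> rng G e
   | None \<Rightarrow> \<not> regular G (fst (x i))" using assms by (auto simp: boundary_paths_def)
  show "snd (x i) = Some e \<Longrightarrow> e \<in> edges G \<and> src G e = fst (x i) \<and> fst (x (Suc i)) \<in> rng G e"
    "snd (x i) = None \<Longrightarrow> \<not> regular G (fst (x i))"
    using * by auto
qed

lemma relator_act_zero:
  assumes "a \<in> lpa_relators G" "x \<in> boundary_paths G"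
  shows "alg_act G a f x = 0"
  using assms(1)
proof cases
  case (regular_vertex v)
  let ?E = "{e \<in> edges G. src G e = v}"
  \<comment> \<open>Only the vertex of the first entry could change, and for a boundary path it is
    \<open>src G e\<close> already.\<close>
  have eta: "case_nat (src G e, Some e) (\<lambda>i. x (Suc i)) = x" if "snd (x 0) = Some e" for e
    using boundary_pathD(1)[OF assms(2) that] that
    by (auto simp: fun_eq_iff prod_eq_iff split: nat.split)
  have act: "word_act G [GenS e, GenSstar e] f x = (if snd (x 0) = Some e then f x else 0)" for e
    using boundary_pathD(1)[OF assms(2), of 0 e] eta[of e] by auto
  \<comment> \<open>At most one edge matches the first entry of \<open>x\<close>. If there is one,
    its source decides whether it belongs to \<open>?E\<close>; if there is none, \<open>x\<close>
    ends at a vertex that is not regular and hence differs from \<open>v\<close>.\<close>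
  have "(\<Sum>e\<in>?E. word_act G [GenS e, GenSstar e] f x) = word_act G [GenP {v}] f x"
  proof (cases "snd (x 0)")
    case None
    then show ?thesis
      using boundary_pathD(2)[OF assms(2) None] regular_vertex
      by (simp only: act) (auto simp: regular_def)
  next
    case (Some e)
    then show ?thesis
      using boundary_pathD(1)[OF assms(2) Some] regular_vertex
      by (simp only: act) (auto simp: regular_def)
  qed
  then show ?thesis
    unfolding regular_vertex gens_monomial monomial_mult by (simp del: word_act_simps)
next
  case (Sstar_S e e')
  then show ?thesis unfolding gens_monomial monomial_mult Sstar_S by auto
next
  case (src_S e)
  then show ?thesis
    using boundary_pathD(1)[OF assms(2), of 0 e] by (simp add: gens_monomial monomial_mult)
next
  case (S_rng e)
  then show ?thesis
    using boundary_pathD(1)[OF assms(2), of 0 e] by (simp add: gens_monomial monomial_mult)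
qed (simp_all add: gens_monomial monomial_mult)

text \<open>The quantification over \<open>f\<close> is inside the induction because a right
  multiple \<open>x * a\<close> acts as \<open>x\<close> on the image of \<open>f\<close> under
  \<open>a\<close>. Left multiples use that functions vanishing on boundary paths are
  preserved.\<close>

lemma ideal_act_zero:
  "a \<in> lpa_ideal G \<Longrightarrow> \<forall>f. \<forall>x\<in>boundary_paths G. alg_act G a f x = 0"
proof (induction rule: lpa_ideal.induct)
  case (relator a)
  then show ?case using relator_act_zero by blast
next
  case (scale a c)
  then show ?case by (simp add: Defs.scale_def alg_act_mult zero_free_monoid_def)
next
  case (mult_left a x)
  then show ?case by (simp add: alg_act_mult alg_act_vanishes)
qed (auto simp: alg_act_mult)

text \<open>From a regular vertex, follow a chosen edge to a chosen vertex of its range, which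
  exists because ranges are nonempty. At any other vertex, stop and repeat that vertex for ever, so
  that the condition holds at all later indices.\<close>

lemma boundary_path_exists: "\<exists>x\<in>boundary_paths G. fst (x 0) = v"
proof -
  define out where "out v = (if regular G v then Some (SOME e. e \<in> edges G \<and> src G e = v) else None)"
    for v
  define step where
    "step v = (case out v of Some e \<Rightarrow> (SOME w. w \<in> rng G e) | None \<Rightarrow> v)" for v
  define x where "x i = ((step ^^ i) v, out ((step ^^ i) v))" for i
  have out: "e \<in> edges G \<and> src G e = w" if "out w = Some e" for w e
  proof -
    have "\<exists>e. e \<in> edges G \<and> src G e = w" "e = (SOME e. e \<in> edges G \<and> src G e = w)"
      using that by (auto simp: out_def regular_def split: if_splits)
    then show ?thesis using someI_ex[of "\<lambda>e. e \<in> edges G \<and> src G e = w"] by simp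
  qed
  have step: "step w \<in> rng G e" if "out w = Some e" for w e
    using that out[OF that] rng_nonempty[of e] by (auto simp: step_def some_in_eq)
  have none: "\<not> regular G w" if "out w = None" for w
    using that by (simp add: out_def split: if_splits)
  have "x \<in> boundary_paths G"
    unfolding boundary_paths_def x_def by (auto split: option.splits dest: out step none)
  then show ?thesis by (intro bexI[of _ x]) (auto simp: x_def)
qed

theorem vertex_notin_ideal: "(P {v} :: ('v, 'e, 'r::comm_ring_1) free_alg) \<notin> lpa_ideal G"
proof
  assume "(P {v} :: ('v, 'e, 'r::comm_ring_1) free_alg) \<in> lpa_ideal G"
  moreover obtain x where "x \<in> boundary_paths G" "fst (x 0) = v" using boundary_path_exists by blast
  \<comment> \<open>The projection sends the constant function 1 to a function with value 1 at
    \<open>x\<close>, and \<open>1 \<noteq> 0\<close> in a \<open>comm_ring_1\<close>.\<close>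
  ultimately have "alg_act G (P {v} :: ('v, 'e, 'r::comm_ring_1) free_alg) (\<lambda>_. 1) x = 0"
    using ideal_act_zero by blast
  with \<open>fst (x 0) = v\<close> show False by (simp add: gens_monomial)
qed

end

section \<open>Words modulo the defining relations\<close>

fun gen_letters :: "('v, 'e) lpa_gen \<Rightarrow> ('e \<times> bool) list" where
  "gen_letters (GenP A) = []"
| "gen_letters (GenS e) = [(e, True)]"
| "gen_letters (GenSstar e) = [(e, False)]"

definition word_degree :: "('v, 'e) lpa_gen list \<Rightarrow> ('e \<times> bool) list" where
  "word_degree w = foldr prefix_letter (concat (map gen_letters w)) []"

lemma word_degree_simps [simp]:
  "word_degree [] = []"
  "word_degree (GenP A # w) = word_degree w"
  "word_degree (GenS e # w) = prefix_letter (e, True) (word_degree w)"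
  "word_degree (GenSstar e # w) = prefix_letter (e, False) (word_degree w)"
  by (simp_all add: word_degree_def)

lemma reduced_word_degree: "reduced (word_degree w)"
  by (simp add: word_degree_def reduced_foldr)

lemma prefix_letter_cancel:
  "reduced w \<Longrightarrow> prefix_letter (e, b) (prefix_letter (e, \<not> b) w) = w"
  using prefix_letter_inverse[of w "(e, b)"] by (simp add: inv_letter_def)

definition path_word :: "'e list \<Rightarrow> ('v, 'e) lpa_gen list" where
  "path_word \<alpha> = map GenS \<alpha>"

definition star_word :: "'e list \<Rightarrow> ('v, 'e) lpa_gen list" where
  "star_word \<beta> = map GenSstar (rev \<beta>)"

lemma path_word_simps [simp]:
  "path_word [] = []" "path_word (e # \<alpha>) = GenS e # path_word \<alpha>"
  "path_word (\<alpha> @ \<beta>) = path_word \<alpha> @ path_word \<beta>"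
  "star_word [] = []" "star_word (e # \<alpha>) = star_word \<alpha> @ [GenSstar e]"
  "star_word (\<alpha> @ \<beta>) = star_word \<beta> @ star_word \<alpha>"
  by (simp_all add: path_word_def star_word_def)

context ultragraph
begin

section \<open>Congruence modulo the ideal of relations\<close>

definition lpa_cong :: "('v, 'e, 'r::comm_ring_1) free_alg \<Rightarrow> ('v, 'e, 'r) free_alg \<Rightarrow> bool"
  (infix \<open>\<approx>\<close> 50) where
  "x \<approx> y \<longleftrightarrow> x - y \<in> lpa_ideal G"

lemma lpa_cong_refl [simp]: "x \<approx> x"
  by (simp add: lpa_cong_def lpa_ideal.zero)

lemma lpa_cong_sym: "x \<approx> y \<Longrightarrow> y \<approx> x"
  unfolding lpa_cong_def using ideal_uminus[of "x - y"] by simp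

lemma lpa_cong_trans [trans]: "x \<approx> y \<Longrightarrow> y \<approx> z \<Longrightarrow> x \<approx> z"
  unfolding lpa_cong_def using lpa_ideal.add[of "x - y" G "y - z"] by simp

lemma lpa_cong_add: "x \<approx> x' \<Longrightarrow> y \<approx> y' \<Longrightarrow> x + y \<approx> x' + y'"
  unfolding lpa_cong_def using lpa_ideal.add[of "x - x'" G "y - y'"] by (simp add: algebra_simps)

lemma lpa_cong_scale: "x \<approx> y \<Longrightarrow> scale c x \<approx> scale c y"
  unfolding lpa_cong_def using lpa_ideal.scale[of "x - y" G c] by (simp add: scale_diff)

text \<open>The prefix \<open>a\<close> may be empty, and then \<open>monomial a\<close> is the 1 of
  the ambient unital algebra, which does not belong to \<open>free_alg G\<close>; the rule
  \<open>mult_left\<close> is restricted to elements of the latter, hence the case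
  distinction.\<close>

lemma lpa_cong_monomial_left:
  fixes x :: "('v, 'e, 'r::comm_ring_1) free_alg"
  assumes "set a \<subseteq> lpa_gens G" "x \<approx> y"
  shows "monomial a * x \<approx> monomial a * y"
proof (cases "a = []")
  case True
  then have "(monomial a :: ('v, 'e, 'r) free_alg) = 1" by (simp add: monomial_def flip: zero_free_monoid_def)
  with assms(2) show ?thesis by simp
next
  case False
  then show ?thesis
    using assms lpa_ideal.mult_left[OF monomial_free_alg[of a G], of "x - y"]
    by (simp add: lpa_cong_def algebra_simps)
qed

lemma lpa_cong_monomial_right:
  fixes x :: "('v, 'e, 'r::comm_ring_1) free_alg"
  assumes "set b \<subseteq> lpa_gens G" "x \<approx> y"
  shows "x * monomial b \<approx> y * monomial b"
proof (cases "b = []")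
  case True
  then have "(monomial b :: ('v, 'e, 'r) free_alg) = 1" by (simp add: monomial_def flip: zero_free_monoid_def)
  with assms(2) show ?thesis by simp
next
  case False
  then show ?thesis
    using assms lpa_ideal.mult_right[OF monomial_free_alg[of b G], of "x - y"]
    by (simp add: lpa_cong_def algebra_simps)
qed

lemma lpa_cong_word:
  assumes "set a \<subseteq> lpa_gens G" "set b \<subseteq> lpa_gens G" "(monomial u :: ('v, 'e, 'r::comm_ring_1) free_alg) \<approx> monomial w"
  shows "(monomial (a @ u @ b) :: ('v, 'e, 'r) free_alg) \<approx> monomial (a @ w @ b)"
  using lpa_cong_monomial_left[OF assms(1) lpa_cong_monomial_right[OF assms(2,3)]]
  by (simp add: monomial_mult)

lemma lpa_cong_word_zero:
  assumes "set a \<subseteq> lpa_gens G" "set b \<subseteq> lpa_gens G" "(monomial u :: ('v, 'e, 'r::comm_ring_1) free_alg) \<approx> 0"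
  shows "(monomial (a @ u @ b) :: ('v, 'e, 'r) free_alg) \<approx> 0"
  using lpa_cong_monomial_left[OF assms(1) lpa_cong_monomial_right[OF assms(2,3)]]
  by (simp add: monomial_mult)

lemma gen_verts_subset: "A \<in> gen_verts G \<Longrightarrow> A \<subseteq> verts G"
  by (induction rule: gen_verts.induct) (use rng_closed in auto)

lemma in_lpa_gens [simp]:
  "GenP A \<in> lpa_gens G \<longleftrightarrow> A \<in> gen_verts G"
  "GenS e \<in> lpa_gens G \<longleftrightarrow> e \<in> edges G"
  "GenSstar e \<in> lpa_gens G \<longleftrightarrow> e \<in> edges G"
  by (auto simp: lpa_gens_def)

lemma set_path_word [simp]:
  "set (path_word \<alpha>) \<subseteq> lpa_gens G \<longleftrightarrow> set \<alpha> \<subseteq> edges G"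
  "set (star_word \<alpha>) \<subseteq> lpa_gens G \<longleftrightarrow> set \<alpha> \<subseteq> edges G"
  by (auto simp: path_word_def star_word_def)

section \<open>Rewriting rules for adjacent generators\<close>

lemma relator_cong: "x - y \<in> lpa_relators G \<Longrightarrow> x \<approx> y"
  by (simp add: lpa_cong_def lpa_ideal.relator)

lemma P_empty_cong: "monomial [GenP {}] \<approx> 0"
  using lpa_ideal.relator[OF lpa_relators.P_empty] by (simp add: lpa_cong_def gens_monomial)

lemma P_P_cong:
  assumes "A \<in> gen_verts G" "B \<in> gen_verts G"
  shows "monomial [GenP A, GenP B] \<approx> monomial [GenP (A \<inter> B)]"
  using relator_cong[OF lpa_relators.P_inter[OF assms]] by (simp add: gens_monomial monomial_mult)

lemma P_src_S_cong: "e \<in> edges G \<Longrightarrow> monomial [GenP {src G e}, GenS e] \<approx> monomial [GenS e]"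
  using relator_cong[OF lpa_relators.src_S] by (simp add: gens_monomial monomial_mult)

lemma Sstar_P_src_cong:
  "e \<in> edges G \<Longrightarrow> monomial [GenSstar e, GenP {src G e}] \<approx> monomial [GenSstar e]"
  using relator_cong[OF lpa_relators.Sstar_src] by (simp add: gens_monomial monomial_mult)

lemma S_P_rng_cong: "e \<in> edges G \<Longrightarrow> monomial [GenS e, GenP (rng G e)] \<approx> monomial [GenS e]"
  using relator_cong[OF lpa_relators.S_rng] by (simp add: gens_monomial monomial_mult)

lemma P_rng_Sstar_cong:
  "e \<in> edges G \<Longrightarrow> monomial [GenP (rng G e), GenSstar e] \<approx> monomial [GenSstar e]"
  using relator_cong[OF lpa_relators.rng_Sstar] by (simp add: gens_monomial monomial_mult)

lemma Sstar_S_cong: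
  assumes "e \<in> edges G" "f \<in> edges G"
  shows "monomial [GenSstar e, GenS f] \<approx> (if e = f then monomial [GenP (rng G e)] else 0)"
  using relator_cong[OF lpa_relators.Sstar_S[OF assms]]
  by (cases "e = f") (simp_all add: gens_monomial monomial_mult)

text \<open>Inserting the projection of the source in front of \<open>S e\<close> turns
  \<open>P A\<close> into the projection of \<open>A \<inter> {src G e}\<close>, which is either
  that of the source or zero.\<close>

lemma P_S_cong:
  assumes "A \<in> gen_verts G" "e \<in> edges G"
  shows "monomial [GenP A, GenS e] \<approx> (if src G e \<in> A then monomial [GenS e] else 0)"
proof -
  have src: "{src G e} \<in> gen_verts G" by (simp add: assms src_closed gen_verts.vertex)
  have "monomial [GenP A, GenS e] \<approx> monomial [GenP A, GenP {src G e}, GenS e]"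
    using lpa_cong_word[OF _ _ P_src_S_cong[OF assms(2), THEN lpa_cong_sym], of "[GenP A]" "[]"]
      assms by simp
  also have "\<dots> \<approx> monomial [GenP (A \<inter> {src G e}), GenS e]"
    using lpa_cong_word[OF _ _ P_P_cong[OF assms(1) src], of "[]" "[GenS e]"] assms by simp
  also have "\<dots> \<approx> (if src G e \<in> A then monomial [GenS e] else 0)"
    using P_src_S_cong[OF assms(2)] lpa_cong_word_zero[OF _ _ P_empty_cong, of "[]" "[GenS e]"]
    by (cases "src G e \<in> A") (simp_all add: assms)
  finally show ?thesis .
qed

lemma Sstar_P_cong:
  assumes "A \<in> gen_verts G" "e \<in> edges G"
  shows "monomial [GenSstar e, GenP A] \<approx> (if src G e \<in> A then monomial [GenSstar e] else 0)"
proof -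
  have src: "{src G e} \<in> gen_verts G" by (simp add: assms src_closed gen_verts.vertex)
  have "monomial [GenSstar e, GenP A] \<approx> monomial [GenSstar e, GenP {src G e}, GenP A]"
    using lpa_cong_word[OF _ _ Sstar_P_src_cong[OF assms(2), THEN lpa_cong_sym], of "[]" "[GenP A]"]
      assms by simp
  also have "\<dots> \<approx> monomial [GenSstar e, GenP ({src G e} \<inter> A)]"
    using lpa_cong_word[OF _ _ P_P_cong[OF src assms(1)], of "[GenSstar e]" "[]"] assms by simp
  also have "\<dots> \<approx> (if src G e \<in> A then monomial [GenSstar e] else 0)"
    using Sstar_P_src_cong[OF assms(2)]
      lpa_cong_word_zero[OF _ _ P_empty_cong, of "[GenSstar e]" "[]"]
    by (cases "src G e \<in> A") (simp_all add: assms)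
  finally show ?thesis .
qed

section \<open>Normal forms with arbitrary lists of edges\<close>

definition nf_word :: "'e list \<Rightarrow> 'v set \<Rightarrow> 'e list \<Rightarrow> ('v, 'e) lpa_gen list" where
  "nf_word \<alpha> A \<beta> = path_word \<alpha> @ GenP A # star_word \<beta>"

lemma set_nf_word [simp]: "set (nf_word \<alpha> A \<beta>) \<subseteq> lpa_gens G \<longleftrightarrow>
    set \<alpha> \<subseteq> edges G \<and> A \<in> gen_verts G \<and> set \<beta> \<subseteq> edges G"
  by (auto simp: nf_word_def)

lemma nf_word_not_Nil [simp]: "nf_word \<alpha> A \<beta> \<noteq> []"
  by (simp add: nf_word_def)

lemma word_degree_nf_word:
  "word_degree (nf_word \<alpha> A \<beta>) = foldr prefix_letter (map (\<lambda>e. (e, True)) \<alpha>)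
     (foldr prefix_letter (map (\<lambda>e. (e, False)) (rev \<beta>)) [])"
proof -
  have "concat (map gen_letters (path_word \<alpha> :: ('v, 'e) lpa_gen list)) = map (\<lambda>e. (e, True)) \<alpha>" for \<alpha> :: "'e list"
    by (induction \<alpha>) auto
  moreover have "concat (map gen_letters (star_word \<beta> :: ('v, 'e) lpa_gen list)) = map (\<lambda>e. (e, False)) (rev \<beta>)"
    for \<beta> :: "'e list"
    by (induction \<beta>) auto
  ultimately show ?thesis by (simp add: nf_word_def word_degree_def)
qed

text \<open>The lists of edges need not be paths yet. Zero is accepted for every \<open>t\<close>,
  since the relations may kill a word of any degree. The middle projection is always present, which
  keeps the normal form a nonempty word.\<close>

definition has_normal_form :: "('v, 'e, 'r::comm_ring_1) free_alg \<Rightarrow> ('e \<times> bool) list \<Rightarrow> bool" where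
  "has_normal_form x t \<longleftrightarrow> x \<approx> 0 \<or> (\<exists>\<alpha> A \<beta>. set \<alpha> \<subseteq> edges G \<and> A \<in> gen_verts G \<and> set \<beta> \<subseteq> edges G \<and>
     x \<approx> monomial (nf_word \<alpha> A \<beta>) \<and> word_degree (nf_word \<alpha> A \<beta>) = t)"

lemma has_normal_form_zero: "x \<approx> 0 \<Longrightarrow> has_normal_form x t"
  by (simp add: has_normal_form_def)

lemma has_normal_form_nf_word:
  assumes "x \<approx> monomial (nf_word \<alpha> A \<beta>)" "set \<alpha> \<subseteq> edges G" "A \<in> gen_verts G" "set \<beta> \<subseteq> edges G"
    "word_degree (nf_word \<alpha> A \<beta>) = t"
  shows "has_normal_form x t"
  using assms unfolding has_normal_form_def by blast

lemma has_normal_form_cong: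
  assumes "x \<approx> y" "has_normal_form y t"
  shows "has_normal_form x t"
  using assms(2) unfolding has_normal_form_def[of y]
proof (elim disjE exE conjE)
  assume "y \<approx> 0"
  from lpa_cong_trans[OF assms(1) this] show ?thesis by (rule has_normal_form_zero)
next
  fix \<alpha> A \<beta>
  assume nf: "set \<alpha> \<subseteq> edges G" "A \<in> gen_verts G" "set \<beta> \<subseteq> edges G"
    "y \<approx> monomial (nf_word \<alpha> A \<beta>)" "word_degree (nf_word \<alpha> A \<beta>) = t"
  from lpa_cong_trans[OF assms(1) nf(4)] nf show ?thesis by (intro has_normal_form_nf_word)
qed

text \<open>A projection on the left meets the first letter of the normal form: it is intersected
  with \<open>A\<close> if \<alpha> is empty, and otherwise the first edge either absorbs it or is
  killed by it. Projections are neutral, so the degree stays.\<close>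

lemma has_normal_form_P:
  assumes "set \<alpha> \<subseteq> edges G" "set \<beta> \<subseteq> edges G" "A \<in> gen_verts G" "B \<in> gen_verts G"
  shows "has_normal_form (monomial (GenP B # nf_word \<alpha> A \<beta>)) (word_degree (nf_word \<alpha> A \<beta>))"
proof (cases \<alpha>)
  case Nil
  show ?thesis
    using lpa_cong_word[OF _ _ P_P_cong[OF assms(4,3)], of "[]" "star_word \<beta>"] assms Nil
    by (intro has_normal_form_nf_word[of _ \<alpha> "B \<inter> A" \<beta>])
      (simp_all add: nf_word_def gen_verts.inter)
next
  case (Cons e \<alpha>')
  have e: "e \<in> edges G" "set (path_word \<alpha>' @ GenP A # star_word \<beta>) \<subseteq> lpa_gens G"
    using assms Cons by auto
  show ?thesis
  proof (cases "src G e \<in> B")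
    case True
    then show ?thesis
      using lpa_cong_word[OF _ e(2), of "[]" "[GenP B, GenS e]" "[GenS e]"]
        P_S_cong[OF assms(4) e(1)] Cons assms
      by (intro has_normal_form_nf_word[of _ \<alpha> A \<beta>]) (simp_all add: nf_word_def)
  next
    case False
    then show ?thesis
      using lpa_cong_word_zero[OF _ e(2), of "[]" "[GenP B, GenS e]"]
        P_S_cong[OF assms(4) e(1)] Cons
      by (intro has_normal_form_zero) (simp add: nf_word_def)
  qed
qed

text \<open>Only a starred edge needs a new argument. It cancels against the first edge of \<alpha>,
  leaving a projection for \<open>has_normal_form_P\<close>, or the product is zero; if \<alpha> is
  empty, it swallows \<open>P A\<close> or is killed by it, and in the former case becomes the last
  edge of \<beta>.\<close>

lemma has_normal_form_gen:
  assumes "set \<alpha> \<subseteq> edges G" "set \<beta> \<subseteq> edges G" "A \<in> gen_verts G" "g \<in> lpa_gens G"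
  shows "has_normal_form (monomial (g # nf_word \<alpha> A \<beta>) :: ('v, 'e, 'r::comm_ring_1) free_alg)
     (word_degree (g # nf_word \<alpha> A \<beta>))"
proof (cases g)
  case (GenP B)
  then show ?thesis using has_normal_form_P assms by simp
next
  case (GenS e)
  then have "g # nf_word \<alpha> A \<beta> = nf_word (e # \<alpha>) A \<beta>" by (simp add: nf_word_def)
  then show ?thesis using assms GenS
    by (intro has_normal_form_nf_word[of _ "e # \<alpha>" A \<beta>]) simp_all
next
  case (GenSstar e)
  then have e: "e \<in> edges G" using assms by simp
  show ?thesis
  proof (cases \<alpha>)
    case Nil
    have *: "(monomial (g # nf_word \<alpha> A \<beta>) :: ('v, 'e, 'r) free_alg) \<approx>
        (if src G e \<in> A then monomial [GenSstar e] else 0) * monomial (star_word \<beta>)"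
      using lpa_cong_monomial_right[OF _ Sstar_P_cong[OF assms(3) e], of "star_word \<beta>"]
        Nil GenSstar assms by (simp add: nf_word_def monomial_mult)
    show ?thesis
    proof (cases "src G e \<in> A")
      case True
      with * have "(monomial (g # nf_word \<alpha> A \<beta>) :: ('v, 'e, 'r) free_alg) \<approx> monomial (GenSstar e # star_word \<beta>)"
        by (simp add: monomial_mult)
      \<comment> \<open>The letter \<open>GenP A\<close> has been consumed, so a new middle
        projection is taken from the range relation of \<open>e\<close>.\<close>
      also have "\<dots> \<approx> monomial (nf_word [] (rng G e) (\<beta> @ [e]))"
        using lpa_cong_word[OF _ _ P_rng_Sstar_cong[OF e, THEN lpa_cong_sym],
          of "[]" "star_word \<beta>"] assms by (simp add: nf_word_def)
      finally show ?thesis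
        by (rule has_normal_form_nf_word)
          (use assms GenSstar e Nil gen_verts.range[OF e] in \<open>simp_all add: word_degree_nf_word\<close>)
    next
      case False
      with * show ?thesis by (intro has_normal_form_zero) simp
    qed
  next
    case (Cons f \<alpha>')
    have f: "f \<in> edges G" "set (nf_word \<alpha>' A \<beta>) \<subseteq> lpa_gens G" using assms Cons by auto
    have *: "(monomial (g # nf_word \<alpha> A \<beta>) :: ('v, 'e, 'r) free_alg) \<approx>
        (if e = f then monomial [GenP (rng G e)] else 0) * monomial (nf_word \<alpha>' A \<beta>)"
      using lpa_cong_monomial_right[OF f(2) Sstar_S_cong[OF e f(1)]] Cons GenSstar
      by (simp add: nf_word_def monomial_mult)
    show ?thesis
    proof (cases "e = f")
      case True
      \<comment> \<open>In step with the relation, the generator \<open>e\<close> and its inverse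
        cancel in the free group.\<close>
      have deg: "word_degree (g # nf_word \<alpha> A \<beta>) = word_degree (nf_word \<alpha>' A \<beta>)"
        using True Cons GenSstar prefix_letter_cancel[OF reduced_word_degree, of e False]
        by (simp add: nf_word_def)
      have "set \<alpha>' \<subseteq> edges G" using assms Cons by simp
      have "(monomial (g # nf_word \<alpha> A \<beta>) :: ('v, 'e, 'r) free_alg) \<approx>
          monomial (GenP (rng G e) # nf_word \<alpha>' A \<beta>)"
        using * True by (simp add: monomial_mult)
      from has_normal_form_cong[OF this
          has_normal_form_P[OF \<open>set \<alpha>' \<subseteq> edges G\<close> assms(2,3) gen_verts.range[OF e]]]
      show ?thesis by (simp only: deg)
    next
      case False
      with * show ?thesis by (intro has_normal_form_zero) simp
    qed
  qed
qed

lemma has_normal_form_monomial: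
  assumes "w \<noteq> []" "set w \<subseteq> lpa_gens G"
  shows "has_normal_form (monomial w :: ('v, 'e, 'r::comm_ring_1) free_alg) (word_degree w)"
  using assms
proof (induction w rule: list_nonempty_induct)
  case (single g)
  show ?case
  proof (cases g)
    case (GenP A)
    then show ?thesis using single
      by (intro has_normal_form_nf_word[of _ "[]" A "[]"]) (simp_all add: nf_word_def)
  next
    case (GenS e)
    then have "e \<in> edges G" using single by simp
    then show ?thesis
      using GenS S_P_rng_cong[THEN lpa_cong_sym] gen_verts.range
      by (intro has_normal_form_nf_word[of _ "[e]" "rng G e" "[]"]) (simp_all add: nf_word_def)
  next
    case (GenSstar e)
    then have "e \<in> edges G" using single by simp
    then show ?thesis
      using GenSstar P_rng_Sstar_cong[THEN lpa_cong_sym] gen_verts.range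
      by (intro has_normal_form_nf_word[of _ "[]" "rng G e" "[e]"]) (simp_all add: nf_word_def)
  qed
next
  case (cons g w)
  then have g: "set [g] \<subseteq> lpa_gens G" "g \<in> lpa_gens G" and w: "set w \<subseteq> lpa_gens G" by auto
  from cons.IH[OF w] show ?case
    unfolding has_normal_form_def[of "monomial w"]
  proof (elim disjE exE conjE)
    assume "(monomial w :: ('v, 'e, 'r) free_alg) \<approx> 0"
    from lpa_cong_word_zero[OF g(1) _ this, of "[]"] show ?thesis
      by (intro has_normal_form_zero) simp
  next
    fix \<alpha> A \<beta>
    assume nf: "set \<alpha> \<subseteq> edges G" "set \<beta> \<subseteq> edges G" "A \<in> gen_verts G"
      "(monomial w :: ('v, 'e, 'r) free_alg) \<approx> monomial (nf_word \<alpha> A \<beta>)"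
      "word_degree (nf_word \<alpha> A \<beta>) = word_degree w"
    have step: "(monomial (g # w) :: ('v, 'e, 'r) free_alg) \<approx> monomial (g # nf_word \<alpha> A \<beta>)"
      using lpa_cong_word[OF g(1) _ nf(4), of "[]"] by simp
    have "word_degree (g # nf_word \<alpha> A \<beta>) = word_degree (g # w)"
      using nf(5) by (cases g) auto
    with has_normal_form_cong[OF step has_normal_form_gen[OF nf(1-3) g(2)]] show ?thesis by simp
  qed
qed

end

section \<open>Path normal forms and local units\<close>

text \<open>Unlike \<open>is_fpath\<close> on edge sequences, this admits the empty list, so one
  notion covers both sides of a normal form; for a side of length zero the middle set alone carries
  the information.\<close>

fun edge_path :: "('v, 'e) ultragraph \<Rightarrow> 'e list \<Rightarrow> bool" where
  "edge_path G [] \<longleftrightarrow> True"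
| "edge_path G [e] \<longleftrightarrow> e \<in> edges G"
| "edge_path G (e # f # \<alpha>) \<longleftrightarrow> e \<in> edges G \<and> src G f \<in> rng G e \<and> edge_path G (f # \<alpha>)"

lemma is_fpath_EdgePath_iff: "is_fpath G (EdgePath \<alpha>) \<longleftrightarrow> \<alpha> \<noteq> [] \<and> edge_path G \<alpha>"
proof (induction G \<alpha> rule: edge_path.induct)
  case (3 G e f \<alpha>)
  then show ?case by (auto simp: less_Suc_eq_0_disj all_conj_distrib)
qed auto

lemma edge_path_ConsD: "edge_path G (e # \<alpha>) \<Longrightarrow> e \<in> edges G \<and> edge_path G \<alpha>"
  by (cases \<alpha>) auto

lemma edge_path_edges: "edge_path G \<alpha> \<Longrightarrow> set \<alpha> \<subseteq> edges G"
  by (induction \<alpha>) (auto dest: edge_path_ConsD)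

lemma edge_path_append: "edge_path G (\<alpha> @ \<beta>) \<longleftrightarrow> edge_path G \<alpha> \<and> edge_path G \<beta> \<and>
    (\<alpha> \<noteq> [] \<and> \<beta> \<noteq> [] \<longrightarrow> src G (hd \<beta>) \<in> rng G (last \<alpha>))"
proof (induction G \<alpha> rule: edge_path.induct)
  case (2 G e)
  then show ?case by (cases \<beta>) auto
qed auto

text \<open>The convention for the empty path makes \<open>P (path_rng G [])\<close> the unit of the algebra when
  \<open>verts G\<close> is a generalized vertex.\<close>

definition path_rng :: "('v, 'e) ultragraph \<Rightarrow> 'e list \<Rightarrow> 'v set" where
  "path_rng G \<alpha> = (if \<alpha> = [] then verts G else rng G (last \<alpha>))"

definition pair_word :: "'e list \<Rightarrow> 'e list \<Rightarrow> ('e \<times> bool) list" where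
  "pair_word \<alpha> \<beta> = map (\<lambda>e. (e, True)) \<alpha> @ map (\<lambda>e. (e, False)) (rev \<beta>)"

text \<open>Signs are constant on each half of \<open>pair_word \<alpha> \<beta>\<close>, so
  cancellation can only occur at the junction, where the last edge of \<alpha> meets the inverse of
  the last edge of \<beta>.\<close>

definition reduced_pair :: "'e list \<Rightarrow> 'e list \<Rightarrow> bool" where
  "reduced_pair \<alpha> \<beta> \<longleftrightarrow> \<alpha> = [] \<or> \<beta> = [] \<or> last \<alpha> \<noteq> last \<beta>"

lemma reduced_pair_sym: "reduced_pair \<alpha> \<beta> \<Longrightarrow> reduced_pair \<beta> \<alpha>"
  by (auto simp: reduced_pair_def)

lemma reduced_append:
  "reduced (u @ w) \<longleftrightarrow> reduced u \<and> reduced w \<and> (u = [] \<or> w = [] \<or> hd w \<noteq> inv_letter (last u))"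
proof (induction u)
  case (Cons l u)
  then show ?case by (cases u; cases w) auto
qed simp

lemma reduced_same_sign: "reduced (map (\<lambda>e. (e, b)) \<alpha>)"
proof (induction \<alpha>)
  case (Cons e \<alpha>)
  then show ?case by (cases \<alpha>) (auto simp: inv_letter_def)
qed simp

lemma reduced_pair_word: "reduced_pair \<alpha> \<beta> \<Longrightarrow> reduced (pair_word \<alpha> \<beta>)"
  by (auto simp: pair_word_def reduced_append reduced_same_sign reduced_pair_def inv_letter_def
      last_map hd_map hd_rev)

text \<open>The positive letters spell \<alpha> and the negative ones the reversal of \<beta>. Thus
  a degree of this form determines the pair from which the local unit is built.\<close>

lemma pair_word_inject: "pair_word \<alpha> \<beta> = pair_word \<alpha>' \<beta>' \<longleftrightarrow> \<alpha> = \<alpha>' \<and> \<beta> = \<beta>'"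
proof
  have "map fst (filter snd (pair_word \<alpha> \<beta>)) = \<alpha>"
    "map fst (filter (\<lambda>l. \<not> snd l) (pair_word \<alpha> \<beta>)) = rev \<beta>" for \<alpha> \<beta> :: "'a list"
    by (simp_all add: pair_word_def filter_map comp_def)
  then show "pair_word \<alpha> \<beta> = pair_word \<alpha>' \<beta>' \<Longrightarrow> \<alpha> = \<alpha>' \<and> \<beta> = \<beta>'" by (metis rev_rev_ident)
qed simp

text \<open>Stripping equal last edges until they differ or one list is exhausted isolates \<gamma>,
  the part that cancels in the degree \<alpha>\<beta>\<inverse>.\<close>

lemma common_suffix:
  obtains \<alpha>' \<beta>' \<gamma> where "\<alpha> = \<alpha>' @ \<gamma>" "\<beta> = \<beta>' @ \<gamma>" "reduced_pair \<alpha>' \<beta>'"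
proof -
  have "\<exists>\<alpha>' \<beta>' \<gamma>. \<alpha> = \<alpha>' @ \<gamma> \<and> \<beta> = \<beta>' @ \<gamma> \<and> reduced_pair \<alpha>' \<beta>'"
  proof (induction \<alpha> arbitrary: \<beta> rule: rev_induct)
    case Nil
    then show ?case by (simp add: reduced_pair_def)
  next
    case (snoc e \<alpha>)
    show ?case
    proof (cases "reduced_pair (\<alpha> @ [e]) \<beta>")
      case False
      then obtain \<beta>\<^sub>0 where "\<beta> = \<beta>\<^sub>0 @ [e]"
        by (cases \<beta> rule: rev_cases) (auto simp: reduced_pair_def)
      with snoc[of \<beta>\<^sub>0] show ?thesis by force
    qed (intro exI[of _ "[]"] exI, auto)
  qed
  with that show ?thesis by blast
qed

lemma foldr_prefix_letter_cancel:
  "reduced w \<Longrightarrow> foldr prefix_letter (map (\<lambda>e. (e, True)) \<gamma>)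
     (foldr prefix_letter (map (\<lambda>e. (e, False)) (rev \<gamma>)) w) = w"
  using foldr_prefix_letter_inverse[of w "map (\<lambda>e. (e, False)) (rev \<gamma>)"]
  by (simp add: rev_map comp_def inv_letter_def)

context ultragraph
begin

lemma word_degree_nf_word_pair:
  assumes "reduced_pair \<alpha> \<beta>"
  shows "word_degree (nf_word (\<alpha> @ \<gamma>) A (\<beta> @ \<gamma>)) = pair_word \<alpha> \<beta>"
  using foldr_prefix_letter_cancel[of "foldr prefix_letter (map (\<lambda>e. (e, False)) (rev \<beta>)) []" \<gamma>]
    foldr_prefix_letter_Nil[OF reduced_pair_word[OF assms]]
  by (simp add: word_degree_nf_word pair_word_def reduced_foldr)

lemma path_rng_gen_verts:
  "verts G \<in> gen_verts G \<Longrightarrow> edge_path G \<alpha> \<Longrightarrow> path_rng G \<alpha> \<in> gen_verts G"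
  using edge_path_edges[of G \<alpha>] last_in_set[of \<alpha>]
  by (auto simp: path_rng_def gen_verts.range subset_iff)

section \<open>Products along paths\<close>

lemma S_S_zero:
  assumes "e \<in> edges G" "f \<in> edges G" "src G f \<notin> rng G e"
  shows "monomial [GenS e, GenS f] \<approx> 0"
proof -
  have "monomial [GenS e, GenS f] \<approx> monomial [GenS e, GenP (rng G e), GenS f]"
    using lpa_cong_word[OF _ _ S_P_rng_cong[OF assms(1), THEN lpa_cong_sym], of "[]" "[GenS f]"]
      assms by simp
  also have "\<dots> \<approx> 0"
    using lpa_cong_word_zero[of "[GenS e]" "[]" "[GenP (rng G e), GenS f]"]
      P_S_cong[OF gen_verts.range[OF assms(1)] assms(2)] assms by simp
  finally show ?thesis .
qed

lemma Sstar_Sstar_zero: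
  assumes "e \<in> edges G" "f \<in> edges G" "src G f \<notin> rng G e"
  shows "monomial [GenSstar f, GenSstar e] \<approx> 0"
proof -
  have "monomial [GenSstar f, GenSstar e] \<approx> monomial [GenSstar f, GenP (rng G e), GenSstar e]"
    using lpa_cong_word[OF _ _ P_rng_Sstar_cong[OF assms(1), THEN lpa_cong_sym],
      of "[GenSstar f]" "[]"] assms by simp
  also have "\<dots> \<approx> 0"
    using lpa_cong_word_zero[of "[]" "[GenSstar e]" "[GenSstar f, GenP (rng G e)]"]
      Sstar_P_cong[OF gen_verts.range[OF assms(1)] assms(2)] assms by simp
  finally show ?thesis .
qed

text \<open>A list of edges that is not a path contains two adjacent edges that do not compose, and
  the product of these two generators is already zero.\<close>

lemma non_path_zero:
  assumes "set \<alpha> \<subseteq> edges G" "\<not> edge_path G \<alpha>"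
  shows "monomial (path_word \<alpha>) \<approx> 0" "monomial (star_word \<alpha>) \<approx> 0"
proof -
  obtain \<alpha>\<^sub>1 e f \<alpha>\<^sub>2 where \<alpha>: "\<alpha> = \<alpha>\<^sub>1 @ [e, f] @ \<alpha>\<^sub>2" "src G f \<notin> rng G e"
    using assms
  proof (induction G \<alpha> arbitrary: thesis rule: edge_path.induct)
    case (3 G e f \<alpha>)
    show ?case
    proof (cases "src G f \<in> rng G e")
      case True
      with 3 obtain \<alpha>\<^sub>1 e' f' \<alpha>\<^sub>2 where "f # \<alpha> = \<alpha>\<^sub>1 @ [e', f'] @ \<alpha>\<^sub>2" "src G f' \<notin> rng G e'"
        by (metis edge_path.simps(3) insert_subset list.simps(15))
      then show ?thesis using 3(2)[of "e # \<alpha>\<^sub>1" e' f' \<alpha>\<^sub>2] by simp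
    qed (use 3(2)[of "[]"] in simp)
  qed auto
  show "monomial (path_word \<alpha>) \<approx> 0"
    using lpa_cong_word_zero[OF _ _ S_S_zero[of e f], of "path_word \<alpha>\<^sub>1" "path_word \<alpha>\<^sub>2"] \<alpha> assms
    by simp
  show "monomial (star_word \<alpha>) \<approx> 0"
    using lpa_cong_word_zero[OF _ _ Sstar_Sstar_zero[of e f], of "star_word \<alpha>\<^sub>2" "star_word \<alpha>\<^sub>1"]
      \<alpha> assms by simp
qed

lemma path_word_P_rng:
  assumes "edge_path G \<alpha>" "\<alpha> \<noteq> []"
  shows "monomial (path_word \<alpha> @ [GenP (rng G (last \<alpha>))]) \<approx> monomial (path_word \<alpha>)"
proof (cases \<alpha> rule: rev_cases)
  case (snoc \<alpha>\<^sub>0 e)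
  then show ?thesis
    using edge_path_edges[OF assms(1)] lpa_cong_word[OF _ _ S_P_rng_cong[of e], of "path_word \<alpha>\<^sub>0" "[]"]
    by simp
qed (use assms in simp)

lemma P_rng_star_word:
  assumes "edge_path G \<alpha>" "\<alpha> \<noteq> []"
  shows "monomial (GenP (rng G (last \<alpha>)) # star_word \<alpha>) \<approx> monomial (star_word \<alpha>)"
proof (cases \<alpha> rule: rev_cases)
  case (snoc \<alpha>\<^sub>0 e)
  then show ?thesis
    using edge_path_edges[OF assms(1)]
      lpa_cong_word[OF _ _ P_rng_Sstar_cong[of e], of "[]" "star_word \<alpha>\<^sub>0"]
    by simp
qed (use assms in simp)

lemma P_path_word:
  assumes "edge_path G \<alpha>" "\<alpha> \<noteq> []" "B \<in> gen_verts G" "src G (hd \<alpha>) \<in> B"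
  shows "monomial (GenP B # path_word \<alpha>) \<approx> monomial (path_word \<alpha>)"
proof (cases \<alpha>)
  case (Cons e \<alpha>')
  then have "e \<in> edges G" "set \<alpha>' \<subseteq> edges G" using edge_path_edges[OF assms(1)] by auto
  with Cons show ?thesis
    using lpa_cong_word[of "[]" "path_word \<alpha>'" "[GenP B, GenS e]" "[GenS e]"] P_S_cong[of B e] assms
    by simp
qed (use assms in simp)

lemma star_word_P:
  assumes "edge_path G \<alpha>" "\<alpha> \<noteq> []" "B \<in> gen_verts G" "src G (hd \<alpha>) \<in> B"
  shows "monomial (star_word \<alpha> @ [GenP B]) \<approx> monomial (star_word \<alpha>)"
proof (cases \<alpha>)
  case (Cons e \<alpha>')
  then have "e \<in> edges G" "set \<alpha>' \<subseteq> edges G" using edge_path_edges[OF assms(1)] by auto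
  with Cons show ?thesis
    using lpa_cong_word[of "star_word \<alpha>'" "[]" "[GenSstar e, GenP B]" "[GenSstar e]"]
      Sstar_P_cong[of B e] assms
    by simp
qed (use assms in simp)

text \<open>The product collapses from the middle: the innermost pair belongs to the first edge and
  becomes its range projection, which the following edge absorbs because its source lies in that
  range.\<close>

lemma star_word_path_word:
  assumes "edge_path G \<alpha>" "\<alpha> \<noteq> []"
  shows "(monomial (star_word \<alpha> @ path_word \<alpha>) :: ('v, 'e, 'r::comm_ring_1) free_alg) \<approx>
    monomial [GenP (rng G (last \<alpha>))]"
  using assms(2,1)
proof (induction \<alpha> rule: list_nonempty_induct)
  case (single e)
  then show ?case using Sstar_S_cong[of e e] by simp
next
  case (cons e \<alpha>)
  have *: "e \<in> edges G" "edge_path G \<alpha>" "set \<alpha> \<subseteq> edges G" "src G (hd \<alpha>) \<in> rng G e"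
    using cons(1,3) edge_path_ConsD[of G e \<alpha>] edge_path_edges[of G \<alpha>] by (cases \<alpha>; auto)+
  have "(monomial (star_word (e # \<alpha>) @ path_word (e # \<alpha>)) :: ('v, 'e, 'r) free_alg) \<approx>
      monomial (star_word \<alpha> @ GenP (rng G e) # path_word \<alpha>)"
    using lpa_cong_word[of "star_word \<alpha>" "path_word \<alpha>" "[GenSstar e, GenS e]" "[GenP (rng G e)]"]
      Sstar_S_cong[of e e] * by simp
  also have "\<dots> \<approx> monomial (star_word \<alpha> @ path_word \<alpha>)"
    using lpa_cong_word[OF _ _ P_path_word[OF *(2) cons(1) gen_verts.range[OF *(1)] *(4)],
        of "star_word \<alpha>" "[]"] * by simp
  also have "\<dots> \<approx> monomial [GenP (rng G (last (e # \<alpha>)))]"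
    using cons * by simp
  finally show ?case .
qed

section \<open>Normal forms with paths\<close>

definition path_triple :: "'e list \<Rightarrow> 'v set \<Rightarrow> 'e list \<Rightarrow> bool" where
  "path_triple \<alpha> A \<beta> \<longleftrightarrow> edge_path G \<alpha> \<and> edge_path G \<beta> \<and> A \<in> gen_verts G \<and>
     A \<subseteq> path_rng G \<alpha> \<and> A \<subseteq> path_rng G \<beta>"

lemma path_triple_sym: "path_triple \<alpha> A \<beta> \<Longrightarrow> path_triple \<beta> A \<alpha>"
  by (auto simp: path_triple_def)

text \<open>The range relation of the last edge inserts the projection of
  \<open>rng G (last \<alpha>)\<close> in front of \<open>P A\<close>, so \<open>A\<close> may be
  cut down to the range. The inclusions in \<open>path_triple\<close> obtained this way later let
  range projections act as the identity when no further edge follows.\<close>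

lemma nf_word_restrict_left:
  assumes "edge_path G \<alpha>" "set \<beta> \<subseteq> edges G" "A \<in> gen_verts G"
  obtains B where "B \<in> gen_verts G" "B \<subseteq> A" "B \<subseteq> path_rng G \<alpha>"
    "(monomial (nf_word \<alpha> A \<beta>) :: ('v, 'e, 'r::comm_ring_1) free_alg) \<approx> monomial (nf_word \<alpha> B \<beta>)"
proof (cases "\<alpha> = []")
  case True
  with that[of A] gen_verts_subset[OF assms(3)] assms show ?thesis by (simp add: path_rng_def)
next
  case False
  have \<alpha>: "set \<alpha> \<subseteq> edges G" "last \<alpha> \<in> edges G" "rng G (last \<alpha>) \<in> gen_verts G"
    using edge_path_edges[OF assms(1)] last_in_set[OF False] by (auto simp: gen_verts.range)
  have "(monomial (nf_word \<alpha> A \<beta>) :: ('v, 'e, 'r) free_alg) \<approx>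
      monomial (path_word \<alpha> @ GenP (rng G (last \<alpha>)) # GenP A # star_word \<beta>)"
    using lpa_cong_word[OF _ _ path_word_P_rng[OF assms(1) False, THEN lpa_cong_sym],
        of "[]" "GenP A # star_word \<beta>"] assms by (simp add: nf_word_def)
  also have "\<dots> \<approx> monomial (nf_word \<alpha> (rng G (last \<alpha>) \<inter> A) \<beta>)"
    using lpa_cong_word[OF _ _ P_P_cong[OF \<alpha>(3) assms(3)], of "path_word \<alpha>" "star_word \<beta>"] assms \<alpha>
    by (simp add: nf_word_def)
  finally show ?thesis
    using that[of "rng G (last \<alpha>) \<inter> A"] False gen_verts.inter[OF \<alpha>(3) assms(3)]
    by (simp add: path_rng_def)
qed

lemma nf_word_restrict_right:
  assumes "set \<alpha> \<subseteq> edges G" "edge_path G \<beta>" "A \<in> gen_verts G"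
  obtains B where "B \<in> gen_verts G" "B \<subseteq> A" "B \<subseteq> path_rng G \<beta>"
    "(monomial (nf_word \<alpha> A \<beta>) :: ('v, 'e, 'r::comm_ring_1) free_alg) \<approx> monomial (nf_word \<alpha> B \<beta>)"
proof (cases "\<beta> = []")
  case True
  with that[of A] gen_verts_subset[OF assms(3)] assms show ?thesis by (simp add: path_rng_def)
next
  case False
  have \<beta>: "set \<beta> \<subseteq> edges G" "last \<beta> \<in> edges G" "rng G (last \<beta>) \<in> gen_verts G"
    using edge_path_edges[OF assms(2)] last_in_set[OF False] by (auto simp: gen_verts.range)
  have "(monomial (nf_word \<alpha> A \<beta>) :: ('v, 'e, 'r) free_alg) \<approx>
      monomial (path_word \<alpha> @ GenP A # GenP (rng G (last \<beta>)) # star_word \<beta>)"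
    using lpa_cong_word[OF _ _ P_rng_star_word[OF assms(2) False, THEN lpa_cong_sym],
        of "path_word \<alpha> @ [GenP A]" "[]"] assms by (simp add: nf_word_def)
  also have "\<dots> \<approx> monomial (nf_word \<alpha> (A \<inter> rng G (last \<beta>)) \<beta>)"
    using lpa_cong_word[OF _ _ P_P_cong[OF assms(3) \<beta>(3)], of "path_word \<alpha>" "star_word \<beta>"] assms \<beta>
    by (simp add: nf_word_def)
  finally show ?thesis
    using that[of "A \<inter> rng G (last \<beta>)"] False gen_verts.inter[OF assms(3) \<beta>(3)]
    by (simp add: path_rng_def)
qed

lemma path_normal_form:
  assumes "w \<noteq> []" "set w \<subseteq> lpa_gens G"
  shows "(monomial w :: ('v, 'e, 'r::comm_ring_1) free_alg) \<approx> 0 \<or>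
    (\<exists>\<alpha> A \<beta>. path_triple \<alpha> A \<beta> \<and>
       (monomial w :: ('v, 'e, 'r) free_alg) \<approx> monomial (nf_word \<alpha> A \<beta>) \<and>
       word_degree (nf_word \<alpha> A \<beta>) = word_degree w)"
  using has_normal_form_monomial[OF assms] unfolding has_normal_form_def
proof (elim disjE exE conjE)
  fix \<alpha> A \<beta>
  assume nf: "set \<alpha> \<subseteq> edges G" "A \<in> gen_verts G" "set \<beta> \<subseteq> edges G"
    "(monomial w :: ('v, 'e, 'r) free_alg) \<approx> monomial (nf_word \<alpha> A \<beta>)"
    "word_degree (nf_word \<alpha> A \<beta>) = word_degree w"
  show ?thesis
  proof (cases "edge_path G \<alpha> \<and> edge_path G \<beta>")
    case True
    obtain B where B: "B \<in> gen_verts G" "B \<subseteq> A" "B \<subseteq> path_rng G \<alpha>"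
      "(monomial (nf_word \<alpha> A \<beta>) :: ('v, 'e, 'r) free_alg) \<approx> monomial (nf_word \<alpha> B \<beta>)"
      using nf_word_restrict_left[of \<alpha> \<beta> A] True nf by blast
    \<comment> \<open>The second cut only shrinks the set, so the inclusion in the range of \<alpha>
      obtained before survives.\<close>
    obtain C where C: "C \<in> gen_verts G" "C \<subseteq> B" "C \<subseteq> path_rng G \<beta>"
      "(monomial (nf_word \<alpha> B \<beta>) :: ('v, 'e, 'r) free_alg) \<approx> monomial (nf_word \<alpha> C \<beta>)"
      using nf_word_restrict_right[of \<alpha> \<beta> B] True nf B(1) by blast
    have "path_triple \<alpha> C \<beta>" using True B C by (auto simp: path_triple_def)
    moreover have "word_degree (nf_word \<alpha> C \<beta>) = word_degree w"
      using nf(5) by (simp add: word_degree_nf_word)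
    ultimately show ?thesis using lpa_cong_trans[OF nf(4) lpa_cong_trans[OF B(4) C(4)]] by blast
  next
    case False
    have "(monomial (nf_word \<alpha> A \<beta>) :: ('v, 'e, 'r) free_alg) \<approx> 0"
    proof (cases "edge_path G \<alpha>")
      case True
      with False have "\<not> edge_path G \<beta>" by simp
      from lpa_cong_word_zero[OF _ _ non_path_zero(2)[OF nf(3) this],
          of "path_word \<alpha> @ [GenP A]" "[]"] nf
      show ?thesis by (simp add: nf_word_def)
    next
      case False
      from lpa_cong_word_zero[OF _ _ non_path_zero(1)[OF nf(1) this],
          of "[]" "GenP A # star_word \<beta>"] nf
      show ?thesis by (simp add: nf_word_def)
    qed
    from lpa_cong_trans[OF nf(4) this] show ?thesis ..
  qed
qed simp

section \<open>Absorption of range projections and local units\<close>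

definition absorbs :: "'v set \<Rightarrow> 'e list \<Rightarrow> 'v set \<Rightarrow> bool" where
  "absorbs B \<gamma> A \<longleftrightarrow> B \<in> gen_verts G \<and> A \<in> gen_verts G \<and> edge_path G \<gamma> \<and>
     (if \<gamma> = [] then A \<subseteq> B else src G (hd \<gamma>) \<in> B)"

text \<open>The two cases of \<open>absorbs\<close> have different reasons: for empty \<gamma> the
  projections of \<open>B\<close> and \<open>A\<close> meet directly and
  \<open>A \<subseteq> B\<close> is required, whereas a nonempty \<gamma> shields \<open>A\<close>
  behind its first edge and only the source of that edge matters.\<close>

lemma absorbs_left:
  assumes "absorbs B \<gamma> A"
  shows "monomial (GenP B # nf_word \<gamma> A \<gamma>) \<approx> monomial (nf_word \<gamma> A \<gamma>)"
proof (cases "\<gamma> = []")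
  case True
  then show ?thesis
    using assms P_P_cong[of B A] by (simp add: absorbs_def nf_word_def Int_absorb1)
next
  case False
  then show ?thesis
    using assms lpa_cong_word[OF _ _ P_path_word[of \<gamma> B], of "[]" "GenP A # star_word \<gamma>"]
      edge_path_edges[of G \<gamma>]
    by (simp add: absorbs_def nf_word_def)
qed

lemma absorbs_right:
  assumes "absorbs B \<gamma> A"
  shows "monomial (nf_word \<gamma> A \<gamma> @ [GenP B]) \<approx> monomial (nf_word \<gamma> A \<gamma>)"
proof (cases "\<gamma> = []")
  case True
  then show ?thesis
    using assms P_P_cong[of A B] by (simp add: absorbs_def nf_word_def Int_absorb2)
next
  case False
  then show ?thesis
    using assms lpa_cong_word[OF _ _ star_word_P[of \<gamma> B], of "path_word \<gamma> @ [GenP A]" "[]"]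
      edge_path_edges[of G \<gamma>]
    by (simp add: absorbs_def nf_word_def)
qed

text \<open>For nonempty \<alpha> the starred and the plain word multiply to the range projection;
  for empty \<alpha> they form the empty word and there is nothing to absorb.\<close>

lemma star_path_absorbs_left:
  assumes "edge_path G \<alpha>" "absorbs (path_rng G \<alpha>) \<gamma> A"
  shows "monomial (star_word \<alpha> @ path_word \<alpha> @ nf_word \<gamma> A \<gamma>) \<approx> monomial (nf_word \<gamma> A \<gamma>)"
proof (cases "\<alpha> = []")
  case False
  have "set (nf_word \<gamma> A \<gamma>) \<subseteq> lpa_gens G"
    using assms edge_path_edges[of G \<gamma>] by (simp add: absorbs_def)
  from lpa_cong_word[OF _ this star_word_path_word[OF assms(1) False], of "[]"]
    absorbs_left[OF assms(2)] False
  show ?thesis by (auto simp: path_rng_def intro: lpa_cong_trans)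
qed simp

lemma star_path_absorbs_right:
  assumes "edge_path G \<alpha>" "absorbs (path_rng G \<alpha>) \<gamma> A"
  shows "monomial (nf_word \<gamma> A \<gamma> @ star_word \<alpha> @ path_word \<alpha>) \<approx> monomial (nf_word \<gamma> A \<gamma>)"
proof (cases "\<alpha> = []")
  case False
  have "set (nf_word \<gamma> A \<gamma>) \<subseteq> lpa_gens G"
    using assms edge_path_edges[of G \<gamma>] by (simp add: absorbs_def)
  from lpa_cong_word[OF this _ star_word_path_word[OF assms(1) False], of "[]"]
    absorbs_right[OF assms(2)] False
  show ?thesis by (auto simp: path_rng_def intro: lpa_cong_trans)
qed simp

text \<open>If \<gamma> is empty, the inclusions in \<open>path_triple\<close> apply; otherwise
  composability of \<open>\<alpha> @ \<gamma>\<close> and \<open>\<beta> @ \<gamma>\<close> puts the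
  source of the first edge of \<gamma> into both ranges. The hypothesis on \<open>verts G\<close>
  makes the range of an empty path a generalized vertex.\<close>

lemma path_triple_absorbs:
  assumes "verts G \<in> gen_verts G" "path_triple (\<alpha> @ \<gamma>) A (\<beta> @ \<gamma>)"
  shows "absorbs (path_rng G \<alpha>) \<gamma> A" "absorbs (path_rng G \<beta>) \<gamma> A"
proof -
  have "src G (hd \<gamma>) \<in> verts G" if "\<gamma> \<noteq> []"
  proof (rule src_closed)
    show "hd \<gamma> \<in> edges G"
      using assms(2) edge_path_edges[of G \<gamma>] hd_in_set[OF that]
      by (auto simp: path_triple_def edge_path_append)
  qed
  then show "absorbs (path_rng G \<alpha>) \<gamma> A" "absorbs (path_rng G \<beta>) \<gamma> A"
    using assms path_rng_gen_verts[OF assms(1), of \<alpha>] path_rng_gen_verts[OF assms(1), of \<beta>]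
    by (auto simp: path_triple_def edge_path_append absorbs_def path_rng_def)
qed

text \<open>The range of \<beta>, not of \<alpha>, sits in the middle because it arises from
  multiplying the starred by the plain word of \<beta>. Once the edges of \<alpha> have collapsed,
  it stands in front of \<open>nf_word \<gamma> A \<gamma>\<close> and is absorbed there because
  \<open>\<beta> @ \<gamma>\<close> is a path as well.\<close>

lemma local_unit_left:
  assumes "verts G \<in> gen_verts G" "path_triple (\<alpha> @ \<gamma>) A (\<beta> @ \<gamma>)"
  shows "(monomial (nf_word \<alpha> (path_rng G \<beta>) \<alpha> @ nf_word (\<alpha> @ \<gamma>) A (\<beta> @ \<gamma>))
      :: ('v, 'e, 'r::comm_ring_1) free_alg) \<approx> monomial (nf_word (\<alpha> @ \<gamma>) A (\<beta> @ \<gamma>))"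
proof -
  note abs = path_triple_absorbs[OF assms]
  have p: "edge_path G \<alpha>" "edge_path G \<beta>" "set \<alpha> \<subseteq> edges G" "set \<beta> \<subseteq> edges G"
    "path_rng G \<beta> \<in> gen_verts G"
    using assms edge_path_edges by (auto simp: path_triple_def edge_path_append path_rng_gen_verts)
  have "(monomial (nf_word \<alpha> (path_rng G \<beta>) \<alpha> @ nf_word (\<alpha> @ \<gamma>) A (\<beta> @ \<gamma>)) :: ('v, 'e, 'r) free_alg)
      \<approx> monomial (path_word \<alpha> @ GenP (path_rng G \<beta>) # nf_word \<gamma> A \<gamma> @ star_word \<beta>)"
    using lpa_cong_word[OF _ _ star_path_absorbs_left[OF p(1) abs(1)],
        of "path_word \<alpha> @ [GenP (path_rng G \<beta>)]" "star_word \<beta>"] p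
    by (simp add: nf_word_def)
  also have "\<dots> \<approx> monomial (path_word \<alpha> @ nf_word \<gamma> A \<gamma> @ star_word \<beta>)"
    using lpa_cong_word[OF _ _ absorbs_left[OF abs(2)], of "path_word \<alpha>" "star_word \<beta>"] p by simp
  finally show ?thesis by (simp add: nf_word_def)
qed

lemma local_unit_right:
  assumes "verts G \<in> gen_verts G" "path_triple (\<alpha> @ \<gamma>) A (\<beta> @ \<gamma>)"
  shows "(monomial (nf_word (\<alpha> @ \<gamma>) A (\<beta> @ \<gamma>) @ nf_word \<beta> (path_rng G \<alpha>) \<beta>)
      :: ('v, 'e, 'r::comm_ring_1) free_alg) \<approx> monomial (nf_word (\<alpha> @ \<gamma>) A (\<beta> @ \<gamma>))"
proof -
  note abs = path_triple_absorbs[OF assms]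
  have p: "edge_path G \<alpha>" "edge_path G \<beta>" "set \<alpha> \<subseteq> edges G" "set \<beta> \<subseteq> edges G"
    "path_rng G \<alpha> \<in> gen_verts G"
    using assms edge_path_edges by (auto simp: path_triple_def edge_path_append path_rng_gen_verts)
  have "(monomial (nf_word (\<alpha> @ \<gamma>) A (\<beta> @ \<gamma>) @ nf_word \<beta> (path_rng G \<alpha>) \<beta>) :: ('v, 'e, 'r) free_alg)
      \<approx> monomial (path_word \<alpha> @ nf_word \<gamma> A \<gamma> @ GenP (path_rng G \<alpha>) # star_word \<beta>)"
    using lpa_cong_word[OF _ _ star_path_absorbs_right[OF p(2) abs(2)],
        of "path_word \<alpha>" "GenP (path_rng G \<alpha>) # star_word \<beta>"] p
    by (simp add: nf_word_def)
  also have "\<dots> \<approx> monomial (path_word \<alpha> @ nf_word \<gamma> A \<gamma> @ star_word \<beta>)"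
    using lpa_cong_word[OF _ _ absorbs_right[OF abs(1)], of "path_word \<alpha>" "star_word \<beta>"] p by simp
  finally show ?thesis by (simp add: nf_word_def)
qed

text \<open>The inner starred and plain edges of \<beta> collapse to its range projection, and
  idempotence removes the surplus copies.\<close>

lemma local_unit_factor:
  assumes "edge_path G \<alpha>" "edge_path G \<beta>" "path_rng G \<beta> \<in> gen_verts G"
  shows "(monomial (nf_word \<alpha> (path_rng G \<beta>) \<beta> @ nf_word \<beta> (path_rng G \<beta>) \<alpha>)
      :: ('v, 'e, 'r::comm_ring_1) free_alg) \<approx> monomial (nf_word \<alpha> (path_rng G \<beta>) \<alpha>)"
proof -
  let ?B = "path_rng G \<beta>"
  have p: "set \<alpha> \<subseteq> edges G" "absorbs ?B [] ?B"
    using assms edge_path_edges by (auto simp: absorbs_def)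
  have "(monomial (nf_word \<alpha> ?B \<beta> @ nf_word \<beta> ?B \<alpha>) :: ('v, 'e, 'r) free_alg) \<approx>
      monomial (path_word \<alpha> @ GenP ?B # GenP ?B # star_word \<alpha>)"
    using lpa_cong_word[OF _ _ star_path_absorbs_left[OF assms(2) p(2)],
        of "path_word \<alpha> @ [GenP ?B]" "star_word \<alpha>"] p assms
    by (simp add: nf_word_def)
  also have "\<dots> \<approx> monomial (nf_word \<alpha> ?B \<alpha>)"
    using lpa_cong_word[OF _ _ absorbs_left[OF p(2)], of "path_word \<alpha>" "star_word \<alpha>"] p
    by (simp add: nf_word_def)
  finally show ?thesis .
qed

end

section \<open>Homogeneous parts\<close>

text \<open>\<open>X\<close> is arbitrary because the multiplication of \<open>free_group X\<close>
  is the same for all \<open>X\<close>; only the carrier, and with it inversion, refers to the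
  generating set.\<close>

lemma word_degree_append:
  "word_degree (u @ w) = word_degree u \<otimes>\<^bsub>free_group X\<^esub> word_degree w"
  using foldr_prefix_letter_assoc[OF reduced_word_degree, of "concat (map gen_letters u)" "[]" w]
  by (simp add: free_group_def word_degree_def)

lemma one_free_group: "\<one>\<^bsub>free_group X\<^esub> = []"
  by (simp add: free_group_def)

lemma pair_word_inv:
  assumes "reduced_pair \<alpha> \<beta>" "set \<alpha> \<subseteq> X" "set \<beta> \<subseteq> X"
  shows "inv\<^bsub>free_group X\<^esub> pair_word \<alpha> \<beta> = pair_word \<beta> \<alpha>"
proof (rule group.inv_equality[OF group_free_group])
  have rev_inv: "rev (map inv_letter (pair_word \<alpha> \<beta>)) = pair_word \<beta> \<alpha>"
    by (simp add: pair_word_def rev_map comp_def inv_letter_def)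
  show "pair_word \<beta> \<alpha> \<otimes>\<^bsub>free_group X\<^esub> pair_word \<alpha> \<beta> = \<one>\<^bsub>free_group X\<^esub>"
    using foldr_prefix_letter_inverse[of "[]" "pair_word \<alpha> \<beta>"]
      foldr_prefix_letter_Nil[OF reduced_pair_word[OF assms(1)]]
    by (simp add: free_group_def rev_inv)
  show "pair_word \<alpha> \<beta> \<in> carrier (free_group X)" "pair_word \<beta> \<alpha> \<in> carrier (free_group X)"
    using assms reduced_pair_word[of \<alpha> \<beta>] reduced_pair_word[of \<beta> \<alpha>] reduced_pair_sym[of \<alpha> \<beta>]
    by (auto simp: free_group_def pair_word_def)
qed

definition hom_part :: "('e \<times> bool) list \<Rightarrow> ('v, 'e, 'r::comm_ring_1) free_alg \<Rightarrow>
    ('v, 'e, 'r) free_alg" where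
  "hom_part t x = (\<Sum>w\<in>{w \<in> Poly_Mapping.keys x. word_degree (letters w) = t}.
     Poly_Mapping.single w (Poly_Mapping.lookup x w))"

definition homogeneous :: "('v, 'e) ultragraph \<Rightarrow> ('e \<times> bool) list \<Rightarrow>
    ('v, 'e, 'r::comm_ring_1) free_alg set" where
  "homogeneous G t = {x \<in> free_alg G. \<forall>w\<in>Poly_Mapping.keys x. word_degree (letters w) = t}"

lemma lookup_hom_part: "Poly_Mapping.lookup (hom_part t x) w =
    (if word_degree (letters w) = t then Poly_Mapping.lookup x w else 0)"
proof (cases "w \<in> Poly_Mapping.keys x")
  case True
  then show ?thesis by (simp add: hom_part_def lookup_sum lookup_single when_def)
next
  case False
  then have "Poly_Mapping.lookup x w = 0" by (simp add: not_in_keys_iff_lookup_eq_zero)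
  with False show ?thesis by (simp add: hom_part_def lookup_sum lookup_single when_def)
qed

lemma hom_part_add: "hom_part t (x + y) = hom_part t x + hom_part t y"
  by (rule poly_mapping_eqI) (simp add: lookup_hom_part lookup_add)

lemma hom_part_diff: "hom_part t (x - y) = hom_part t x - hom_part t y"
  by (rule poly_mapping_eqI) (simp add: lookup_hom_part lookup_minus)

lemma hom_part_zero [simp]: "hom_part t 0 = 0"
  by (rule poly_mapping_eqI) (simp add: lookup_hom_part)

lemma hom_part_sum: "hom_part t (sum f I) = (\<Sum>i\<in>I. hom_part t (f i))"
  by (induction I rule: infinite_finite_induct) (simp_all add: hom_part_add)

lemma hom_part_single: "hom_part t (Poly_Mapping.single w c) =
    (if word_degree (letters w) = t then Poly_Mapping.single w c else 0)"
  by (rule poly_mapping_eqI) (simp add: lookup_hom_part lookup_single when_def)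

lemma hom_part_scale: "hom_part t (scale c x) = scale c (hom_part t x)"
proof (induction x rule: poly_mapping_single_induct)
  case (single w d)
  then show ?case by (simp add: scale_def mult_single hom_part_single)
next
  case (add a b)
  then show ?case by (simp add: scale_def ring_distribs hom_part_add)
qed (simp add: scale_def)

lemma hom_part_homogeneous: "x \<in> free_alg G \<Longrightarrow> hom_part t x \<in> homogeneous G t"
  by (auto simp: homogeneous_def free_alg_def in_keys_iff lookup_hom_part split: if_splits)

lemma hom_part_of_homogeneous:
  assumes "x \<in> homogeneous G s"
  shows "hom_part t x = (if t = s then x else 0)"
proof (rule poly_mapping_eqI)
  fix w
  show "Poly_Mapping.lookup (hom_part t x) w = Poly_Mapping.lookup (if t = s then x else 0) w"
    using assms
    by (cases "w \<in> Poly_Mapping.keys x")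
      (auto simp: homogeneous_def lookup_hom_part not_in_keys_iff_lookup_eq_zero)
qed

lemma sum_hom_part:
  assumes "finite D" "(\<lambda>w. word_degree (letters w)) ` Poly_Mapping.keys x \<subseteq> D"
  shows "(\<Sum>t\<in>D. hom_part t x) = x"
proof (rule poly_mapping_eqI)
  fix w
  show "Poly_Mapping.lookup (\<Sum>t\<in>D. hom_part t x) w = Poly_Mapping.lookup x w"
    using assms
    by (cases "w \<in> Poly_Mapping.keys x")
      (auto simp: lookup_sum lookup_hom_part not_in_keys_iff_lookup_eq_zero)
qed

lemma homogeneous_free_alg: "x \<in> homogeneous G t \<Longrightarrow> x \<in> free_alg G"
  by (simp add: homogeneous_def)

lemma homogeneous_zero: "0 \<in> homogeneous G t"
  by (simp add: homogeneous_def free_alg_zero)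

lemma homogeneous_add: "x \<in> homogeneous G t \<Longrightarrow> y \<in> homogeneous G t \<Longrightarrow> x + y \<in> homogeneous G t"
  using Poly_Mapping.keys_add[of x y] by (auto simp: homogeneous_def free_alg_add)

lemma homogeneous_uminus: "x \<in> homogeneous G t \<Longrightarrow> - x \<in> homogeneous G t"
  by (simp add: homogeneous_def free_alg_uminus)

lemma homogeneous_diff: "x \<in> homogeneous G t \<Longrightarrow> y \<in> homogeneous G t \<Longrightarrow> x - y \<in> homogeneous G t"
  using homogeneous_add[of x G t "- y"] by (simp add: homogeneous_uminus)

lemma homogeneous_sum:
  "(\<And>i. i \<in> I \<Longrightarrow> f i \<in> homogeneous G t) \<Longrightarrow> sum f I \<in> homogeneous G t"
  by (induction I rule: infinite_finite_induct) (auto intro: homogeneous_zero homogeneous_add)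

lemma homogeneous_scale: "x \<in> homogeneous G t \<Longrightarrow> scale c x \<in> homogeneous G t"
  unfolding homogeneous_def
  using free_alg_scale[of x G c] keys_mult[of "Poly_Mapping.single 0 c" x]
  by (auto simp: scale_def split: if_splits)

lemma homogeneous_monomial:
  "w \<noteq> [] \<Longrightarrow> set w \<subseteq> lpa_gens G \<Longrightarrow> word_degree w = t \<Longrightarrow> monomial w \<in> homogeneous G t"
  by (simp add: homogeneous_def monomial_free_alg) (simp add: monomial_def)

lemma homogeneous_mult:
  assumes "x \<in> homogeneous G s" "y \<in> homogeneous G t"
  shows "x * y \<in> homogeneous G (s \<otimes>\<^bsub>free_group X\<^esub> t)"
proof -
  have "word_degree (letters (u + w)) = s \<otimes>\<^bsub>free_group X\<^esub> t"
    if "u \<in> Poly_Mapping.keys x" "w \<in> Poly_Mapping.keys y" for u w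
    using assms that by (simp add: homogeneous_def plus_free_monoid_def word_degree_append[of _ _ X])
  then show ?thesis
    unfolding homogeneous_def using keys_mult[of x y] assms
    by (auto simp: free_alg_mult homogeneous_free_alg)
qed

context ultragraph
begin

lemma word_degree_carrier:
  assumes "set w \<subseteq> lpa_gens G"
  shows "word_degree w \<in> carrier (free_group (edges G))"
proof -
  have "fst ` set (gen_letters g) \<subseteq> edges G" if "g \<in> lpa_gens G" for g
    using that by (cases g) auto
  then have "fst ` set (concat (map gen_letters w)) \<subseteq> edges G"
    using assms by (fastforce simp: image_iff)
  moreover have "fst ` set (word_degree w) \<subseteq> fst ` set (concat (map gen_letters w))"
    unfolding word_degree_def
    using set_foldr_prefix_letter[of "concat (map gen_letters w)" "[]"] by (intro image_mono) simp
  ultimately have "fst ` set (word_degree w) \<subseteq> edges G" by (rule order_trans[rotated])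
  then show ?thesis by (simp add: free_group_def reduced_word_degree)
qed

lemma relator_homogeneous: "x \<in> lpa_relators G \<Longrightarrow> \<exists>t. x \<in> homogeneous G t"
proof (induction rule: lpa_relators.induct)
  case (Sstar_S e f)
  \<comment> \<open>The witness is the degree of the first term. For \<open>e = f\<close> it is
    neutral, like the projection; for \<open>e \<noteq> f\<close> the other term is 0, which is
    homogeneous of every degree.\<close>
  then show ?case
    by (intro exI[of _ "[(e, False)] \<otimes>\<^bsub>free_group UNIV\<^esub> [(f, True)]"])
      (auto simp: gens_monomial monomial_mult free_group_def inv_letter_def gen_verts.range
        intro!: homogeneous_diff homogeneous_monomial homogeneous_zero)
next
  case (src_S e)
  then show ?case
    by (intro exI[of _ "[(e, True)]"]) (auto simp: gens_monomial monomial_mult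
        gen_verts.vertex src_closed intro!: homogeneous_diff homogeneous_monomial)
next
  case (S_rng e)
  then show ?case
    by (intro exI[of _ "[(e, True)]"]) (auto simp: gens_monomial monomial_mult
        gen_verts.range intro!: homogeneous_diff homogeneous_monomial)
next
  case (rng_Sstar e)
  then show ?case
    by (intro exI[of _ "[(e, False)]"]) (auto simp: gens_monomial monomial_mult
        gen_verts.range intro!: homogeneous_diff homogeneous_monomial)
next
  case (Sstar_src e)
  then show ?case
    by (intro exI[of _ "[(e, False)]"]) (auto simp: gens_monomial monomial_mult
        gen_verts.vertex src_closed intro!: homogeneous_diff homogeneous_monomial)
next
  case (regular_vertex v)
  then show ?case
    by (intro exI[of _ "[]"]) (auto simp: gens_monomial monomial_mult inv_letter_def
        gen_verts.vertex intro!: homogeneous_diff homogeneous_sum homogeneous_monomial)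
next
  case (P_inter A B)
  then show ?case
    by (intro exI[of _ "[]"]) (simp add: gens_monomial monomial_mult
        gen_verts.inter homogeneous_diff homogeneous_monomial)
next
  case (P_union A B)
  then show ?case
    by (intro exI[of _ "[]"]) (simp add: gens_monomial monomial_mult
        gen_verts.inter gen_verts.union homogeneous_diff homogeneous_add homogeneous_monomial)
next
  case P_empty
  then show ?case
    by (intro exI[of _ "[]"]) (simp add: gens_monomial gen_verts.empty homogeneous_monomial)
qed

text \<open>Multiplication by a single word translates degrees, so each homogeneous part of the
  product comes from one part of \<open>x\<close>. For a general left factor several parts would
  mix, which is why \<open>hom_part_ideal\<close> splits its factors into words.\<close>

lemma hom_part_single_mult:
  assumes "set (letters u) \<subseteq> lpa_gens G" "x \<in> free_alg G" "t \<in> carrier (free_group (edges G))"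
  shows "hom_part t (Poly_Mapping.single u c * x) =
    Poly_Mapping.single u c *
      hom_part (inv\<^bsub>free_group (edges G)\<^esub> word_degree (letters u) \<otimes>\<^bsub>free_group (edges G)\<^esub> t) x"
proof (induction x rule: poly_mapping_single_induct)
  case (single w d)
  then have "set (letters w) \<subseteq> lpa_gens G" using assms(2) by (simp add: free_alg_def)
  then show ?case
    using group.inv_solve_left[OF group_free_group word_degree_carrier[of "letters w"]
        word_degree_carrier[OF assms(1)] assms(3)]
    by (auto simp: mult_single hom_part_single plus_free_monoid_def
        word_degree_append[of _ _ "edges G"])
next
  case (add x y)
  then show ?case by (simp add: ring_distribs hom_part_add)
qed simp

lemma hom_part_mult_single:
  assumes "set (letters u) \<subseteq> lpa_gens G" "x \<in> free_alg G" "t \<in> carrier (free_group (edges G))"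
  shows "hom_part t (x * Poly_Mapping.single u c) =
      hom_part (t \<otimes>\<^bsub>free_group (edges G)\<^esub> inv\<^bsub>free_group (edges G)\<^esub> word_degree (letters u)) x *
      Poly_Mapping.single u c"
proof (induction x rule: poly_mapping_single_induct)
  case (single w d)
  then have "set (letters w) \<subseteq> lpa_gens G" using assms(2) by (simp add: free_alg_def)
  then show ?case
    using group.inv_solve_right[OF group_free_group word_degree_carrier[of "letters w"]
        assms(3) word_degree_carrier[OF assms(1)]]
    by (auto simp: mult_single hom_part_single plus_free_monoid_def
        word_degree_append[of _ _ "edges G"])
next
  case (add x y)
  then show ?case by (simp add: ring_distribs hom_part_add)
qed simp

lemma single_free_alg:
  "letters w \<noteq> [] \<Longrightarrow> set (letters w) \<subseteq> lpa_gens G \<Longrightarrow> Poly_Mapping.single w c \<in> free_alg G"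
  by (auto simp: free_alg_def)

text \<open>The degree \<open>t\<close> is quantified inside the induction because a word multiplied
  from either side shifts it. Relators are homogeneous, so taking a part keeps or kills
  them.\<close>

lemma hom_part_ideal:
  "x \<in> lpa_ideal G \<Longrightarrow> \<forall>t\<in>carrier (free_group (edges G)). hom_part t x \<in> lpa_ideal G"
proof (induction rule: lpa_ideal.induct)
  case zero
  then show ?case by (simp add: lpa_ideal.zero)
next
  case (relator x)
  then obtain s where "x \<in> homogeneous G s" using relator_homogeneous by blast
  with relator show ?case
    by (simp add: hom_part_of_homogeneous lpa_ideal.zero lpa_ideal.relator)
next
  case (add x y)
  then show ?case by (simp add: hom_part_add lpa_ideal.add)
next
  case (scale x c)
  then show ?case by (simp add: hom_part_scale lpa_ideal.scale)
next
  case (mult_left a x)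
  have x: "x \<in> free_alg G" using mult_left ideal_free_alg by blast
  show ?case
  proof
    fix t assume t: "t \<in> carrier (free_group (edges G))"
    show "hom_part t (a * x) \<in> lpa_ideal G"
    proof (induction a rule: poly_mapping_single_induct)
      case (single w c)
      with mult_left(1) have w: "letters w \<noteq> []" "set (letters w) \<subseteq> lpa_gens G"
        by (auto simp: free_alg_def)
      interpret F: group "free_group (edges G)" by (rule group_free_group)
      show ?case
        unfolding hom_part_single_mult[OF w(2) x t] using mult_left(3)
        by (intro lpa_ideal.mult_left single_free_alg w) (simp add: word_degree_carrier w t)
    next
      case (add a b)
      then show ?case by (simp add: ring_distribs hom_part_add lpa_ideal.add)
    qed (simp add: lpa_ideal.zero)
  qed
next
  case (mult_right a x)
  have x: "x \<in> free_alg G" using mult_right ideal_free_alg by blast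
  show ?case
  proof
    fix t assume t: "t \<in> carrier (free_group (edges G))"
    show "hom_part t (x * a) \<in> lpa_ideal G"
    proof (induction a rule: poly_mapping_single_induct)
      case (single w c)
      with mult_right(1) have w: "letters w \<noteq> []" "set (letters w) \<subseteq> lpa_gens G"
        by (auto simp: free_alg_def)
      interpret F: group "free_group (edges G)" by (rule group_free_group)
      show ?case
        unfolding hom_part_mult_single[OF w(2) x t] using mult_right(3)
        by (intro lpa_ideal.mult_right single_free_alg w) (simp add: word_degree_carrier w t)
    next
      case (add a b)
      then show ?case by (simp add: ring_distribs hom_part_add lpa_ideal.add)
    qed (simp add: lpa_ideal.zero)
  qed
qed

end

section \<open>The grading\<close>

fun fpath_word :: "('v, 'e) fpath \<Rightarrow> ('v, 'e) lpa_gen list" where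
  "fpath_word (GenVertex A) = [GenP A]"
| "fpath_word (EdgePath \<alpha>) = path_word \<alpha>"

fun fpath_star_word :: "('v, 'e) fpath \<Rightarrow> ('v, 'e) lpa_gen list" where
  "fpath_star_word (GenVertex A) = [GenP A]"
| "fpath_star_word (EdgePath \<alpha>) = star_word \<alpha>"

context ultragraph
begin

section \<open>Passing from representatives to classes\<close>

abbreviation lpa :: "('r::comm_ring_1, ('v, 'e, 'r) free_alg set) module" where
  "lpa \<equiv> leavitt_path_algebra G"

lemma class_eq_iff_cong: "x \<in> free_alg G \<Longrightarrow> lpa_class G x = lpa_class G y \<longleftrightarrow> x \<approx> y"
  by (simp add: class_eq_iff lpa_cong_def)

lemma class_in_carrier: "x \<in> free_alg G \<Longrightarrow> lpa_class G x \<in> carrier lpa"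
  by (simp add: carrier_lpa)

lemma class_finsum:
  fixes f :: "'i \<Rightarrow> ('v, 'e, 'r::comm_ring_1) free_alg"
  assumes "finite I" "\<And>i. i \<in> I \<Longrightarrow> f i \<in> free_alg G"
  shows "(\<Oplus>\<^bsub>lpa\<^esub>i\<in>I. lpa_class G (f i)) = lpa_class G (sum f I)"
  using assms
proof (induction I)
  interpret nonunital_ring "lpa :: ('r, ('v, 'e, 'r) free_alg set) module"
    by (rule nonunital_ring_lpa)
  case empty
  then show ?case by (simp add: zero_lpa)
next
  interpret nonunital_ring "lpa :: ('r, ('v, 'e, 'r) free_alg set) module"
    by (rule nonunital_ring_lpa)
  case (insert i I)
  then show ?case
    by (subst finsum_insert) (auto simp: class_in_carrier class_add free_alg_sum)
qed

lemma class_uminus: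
  fixes x :: "('v, 'e, 'r::comm_ring_1) free_alg"
  assumes "x \<in> free_alg G"
  shows "\<ominus>\<^bsub>lpa\<^esub> lpa_class G x = lpa_class G (- x)"
proof -
  interpret nonunital_ring "lpa :: ('r, ('v, 'e, 'r) free_alg set) module"
    by (rule nonunital_ring_lpa)
  show ?thesis
    using assms
    by (intro minus_equality) (simp_all add: class_add class_in_carrier free_alg_uminus zero_lpa)
qed

text \<open>Choosing representatives turns a span of classes into classes of linear combinations, so
  that membership in a component can be decided in the free algebra.\<close>

lemma linear_span_class:
  fixes Y :: "('v, 'e, 'r::comm_ring_1) free_alg set"
  assumes "Y \<subseteq> free_alg G"
  shows "linear_span lpa (lpa_class G ` Y) =
    {lpa_class G (\<Sum>i<n. scale (c i) (y i)) | (n :: nat) c y. \<forall>i<n. y i \<in> Y}"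
proof -
  have sum: "(\<Oplus>\<^bsub>lpa\<^esub>i\<in>{..<n}. c i \<odot>\<^bsub>lpa\<^esub> x i) = lpa_class G (\<Sum>i<n. scale (c i) (y i))"
    if "\<forall>i<n. y i \<in> Y \<and> x i = lpa_class G (y i)" for n c x and y :: "nat \<Rightarrow> ('v, 'e, 'r) free_alg"
  proof -
    interpret nonunital_ring "lpa :: ('r, ('v, 'e, 'r) free_alg set) module"
      by (rule nonunital_ring_lpa)
    have y: "y i \<in> free_alg G" "x i = lpa_class G (y i)" if "i < n" for i
      using \<open>\<forall>i<n. _\<close> that assms by auto
    have "(\<Oplus>\<^bsub>lpa\<^esub>i\<in>{..<n}. c i \<odot>\<^bsub>lpa\<^esub> x i) = (\<Oplus>\<^bsub>lpa\<^esub>i\<in>{..<n}. lpa_class G (scale (c i) (y i)))"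
      using y by (intro finsum_cong') (auto simp: class_scale class_in_carrier free_alg_scale)
    also have "\<dots> = lpa_class G (\<Sum>i<n. scale (c i) (y i))"
      using y by (intro class_finsum) (auto intro: free_alg_scale)
    finally show ?thesis .
  qed
  show ?thesis
  proof (intro equalityI subsetI)
    fix z assume "z \<in> linear_span lpa (lpa_class G ` Y)"
    then obtain n :: nat and c x where z: "z = (\<Oplus>\<^bsub>lpa\<^esub>i\<in>{..<n}. c i \<odot>\<^bsub>lpa\<^esub> x i)"
      "\<forall>i<n. x i \<in> lpa_class G ` Y" unfolding linear_span_def by blast
    then have "\<forall>i. \<exists>y. i < n \<longrightarrow> y \<in> Y \<and> x i = lpa_class G y" by blast
    then obtain y where "\<forall>i<n. y i \<in> Y \<and> x i = lpa_class G (y i)" by metis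
    from this sum[OF this] z(1)
    show "z \<in> {lpa_class G (\<Sum>i<n. scale (c i) (y i)) | (n :: nat) c y. \<forall>i<n. y i \<in> Y}" by blast
  next
    fix z assume "z \<in> {lpa_class G (\<Sum>i<n. scale (c i) (y i)) | (n :: nat) c y. \<forall>i<n. y i \<in> Y}"
    then obtain n :: nat and c y where z: "z = lpa_class G (\<Sum>i<n. scale (c i) (y i))"
      "\<forall>i<n. y i \<in> Y" by blast
    from z(2) have "\<forall>i<n. y i \<in> Y \<and> lpa_class G (y i) = lpa_class G (y i)" by simp
    from sum[OF this, of c] z show "z \<in> linear_span lpa (lpa_class G ` Y)"
      unfolding linear_span_def by force
  qed
qed

lemma linear_span_class_zero:
  "Y \<subseteq> free_alg G \<Longrightarrow> lpa_class G 0 \<in> linear_span lpa (lpa_class G ` Y)"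
  unfolding linear_span_class by (auto intro!: exI[of _ "0 :: nat"])

lemma linear_span_class_add:
  assumes "Y \<subseteq> free_alg G" "x \<in> free_alg G" "y \<in> Y"
    "lpa_class G x \<in> linear_span lpa (lpa_class G ` Y)"
  shows "lpa_class G (x + scale c y) \<in> linear_span lpa (lpa_class G ` Y)"
proof -
  obtain n :: nat and d z where z: "lpa_class G x = lpa_class G (\<Sum>i<n. scale (d i) (z i))"
    "\<forall>i<n. z i \<in> Y" using assms(4) unfolding linear_span_class[OF assms(1)] by blast
  have "lpa_class G (x + scale c y) =
      lpa_class G (\<Sum>i<Suc n. scale ((d(n := c)) i) ((z(n := y)) i))"
    using z(1) assms
    by (subst class_eq_iff) (auto simp: class_eq_iff free_alg_add free_alg_scale)
  moreover have "\<forall>i<Suc n. (z(n := y)) i \<in> Y" using z(2) assms(3) by (auto simp: less_Suc_eq)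
  ultimately show ?thesis unfolding linear_span_class[OF assms(1)] by blast
qed

lemma nonempty_prod_class:
  assumes "\<alpha> \<noteq> []" "\<And>e. e \<in> set \<alpha> \<Longrightarrow> g e \<in> lpa_gens G"
  shows "nonempty_prod lpa (map (\<lambda>e. lpa_class G (monomial [g e])) \<alpha>) =
    lpa_class G (monomial (map g \<alpha>) :: ('v, 'e, 'r::comm_ring_1) free_alg)"
  using assms
proof (induction \<alpha> rule: list_nonempty_induct)
  case (cons e \<alpha>)
  then obtain f \<alpha>' where \<alpha>: "\<alpha> = f # \<alpha>'" by (cases \<alpha>) auto
  have "set (map g \<alpha>) \<subseteq> lpa_gens G" using cons(3) by auto
  then have "(monomial [g e] :: ('v, 'e, 'r) free_alg) \<in> free_alg G"
    "(monomial (map g \<alpha>) :: ('v, 'e, 'r) free_alg) \<in> free_alg G"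
    using cons by (auto intro!: monomial_free_alg)
  note mult = class_mult[OF this]
  have "nonempty_prod lpa (map (\<lambda>e. lpa_class G (monomial [g e])) (e # \<alpha>)) =
      lpa_class G (monomial [g e]) \<otimes>\<^bsub>lpa\<^esub>
      lpa_class G (monomial (map g \<alpha>) :: ('v, 'e, 'r) free_alg)"
    using cons \<alpha> by simp
  also have "\<dots> = lpa_class G (monomial (map g (e # \<alpha>)))"
    by (simp add: mult monomial_mult)
  finally show ?case .
qed simp

lemma fpath_word_valid:
  assumes "is_fpath G \<alpha>"
  shows "fpath_word \<alpha> \<noteq> []" "set (fpath_word \<alpha>) \<subseteq> lpa_gens G"
    "fpath_star_word \<alpha> \<noteq> []" "set (fpath_star_word \<alpha>) \<subseteq> lpa_gens G"
  using assms by (cases \<alpha>; auto simp: path_word_def star_word_def subset_iff)+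

lemma path_elem_eq:
  assumes "is_fpath G \<alpha>"
  shows "path_elem G \<alpha> = lpa_class G (monomial (fpath_word \<alpha>))"
    "path_elem_star G \<alpha> = lpa_class G (monomial (fpath_star_word \<alpha>))"
  using assms nonempty_prod_class[of _ GenS] nonempty_prod_class[of "rev _" GenSstar]
  by (cases \<alpha>; auto simp: gens_monomial path_word_def star_word_def subset_iff)+

lemma path_degree_eq: "path_degree G \<alpha> = word_degree (fpath_word \<alpha>)"
proof (cases \<alpha>)
  case (EdgePath es)
  have "foldr (\<lambda>e w. free_gen e \<otimes>\<^bsub>free_group (edges G)\<^esub> w) es \<one>\<^bsub>free_group (edges G)\<^esub> =
      word_degree (path_word es)"
    by (induction es) (simp_all add: free_group_def free_gen_def)
  with EdgePath show ?thesis by simp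
qed (simp add: one_free_group)

lemma inv_path_degree:
  assumes "is_fpath G \<beta>"
  shows "inv\<^bsub>free_group (edges G)\<^esub> path_degree G \<beta> = word_degree (fpath_star_word \<beta>)"
proof -
  interpret F: group "free_group (edges G)" by (rule group_free_group)
  have "word_degree (fpath_word \<beta>) \<otimes>\<^bsub>free_group (edges G)\<^esub> word_degree (fpath_star_word \<beta>) =
      \<one>\<^bsub>free_group (edges G)\<^esub>"
  proof (cases \<beta>)
    case (EdgePath es)
    \<comment> \<open>The set \<open>{}\<close> is a dummy: projections do not affect the degree,
      and with the whole path as common suffix everything cancels.\<close>
    have "word_degree (path_word es @ star_word es :: ('v, 'e) lpa_gen list) =
        word_degree (nf_word es {} es)"
      by (simp add: nf_word_def word_degree_def)
    also have "\<dots> = []" using word_degree_nf_word_pair[of "[]" "[]" es]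
      by (simp add: reduced_pair_def pair_word_def)
    finally show ?thesis using EdgePath by (simp add: one_free_group flip: word_degree_append)
  qed (simp add: free_group_def)
  then have "inv\<^bsub>free_group (edges G)\<^esub> word_degree (fpath_star_word \<beta>) = word_degree (fpath_word \<beta>)"
    by (intro F.inv_equality) (simp_all add: word_degree_carrier fpath_word_valid[OF assms])
  then show ?thesis
    using F.inv_inv[OF word_degree_carrier[OF fpath_word_valid(4)[OF assms]]]
    by (simp add: path_degree_eq)
qed

section \<open>The components as images of homogeneous elements\<close>

definition spanning_words :: "('e \<times> bool) list \<Rightarrow> ('v, 'e) lpa_gen list set" where
  "spanning_words t = {fpath_word \<alpha> @ GenP A # fpath_star_word \<beta> | \<alpha> A \<beta>.
     is_fpath G \<alpha> \<and> is_fpath G \<beta> \<and> A \<in> gen_verts G \<and>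
     word_degree (fpath_word \<alpha> @ GenP A # fpath_star_word \<beta>) = t}"

lemma spanning_words_homogeneous: "monomial ` spanning_words t \<subseteq> homogeneous G t"
  by (auto simp: spanning_words_def dest: fpath_word_valid(2,4)[THEN subsetD]
      intro!: homogeneous_monomial)

lemma lpa_component_spanning_words:
  "(lpa_component G t :: ('v, 'e, 'r::comm_ring_1) free_alg set set) =
    linear_span lpa (lpa_class G ` monomial ` spanning_words t)"
proof -
  have elem: "path_elem G \<alpha> \<otimes>\<^bsub>lpa\<^esub> lpa_class G (P A) \<otimes>\<^bsub>lpa\<^esub> path_elem_star G \<beta> =
      lpa_class G (monomial (fpath_word \<alpha> @ GenP A # fpath_star_word \<beta>))"
    if "is_fpath G \<alpha>" "is_fpath G \<beta>" "A \<in> gen_verts G" for \<alpha> A \<beta>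
    using that fpath_word_valid
    by (simp add: path_elem_eq gens_monomial class_mult free_alg_mult monomial_free_alg monomial_mult)
  have degree: "path_degree G \<alpha> \<otimes>\<^bsub>free_group (edges G)\<^esub> inv\<^bsub>free_group (edges G)\<^esub> path_degree G \<beta> =
      word_degree (fpath_word \<alpha> @ GenP A # fpath_star_word \<beta>)"
    if "is_fpath G \<beta>" for \<alpha> A \<beta>
    using that word_degree_append[of "fpath_word \<alpha>" "GenP A # fpath_star_word \<beta>" "edges G"]
    by (simp add: inv_path_degree) (simp add: path_degree_eq)
  have "{path_elem G \<alpha> \<otimes>\<^bsub>lpa\<^esub> lpa_class G (P A) \<otimes>\<^bsub>lpa\<^esub> path_elem_star G \<beta> | \<alpha> A \<beta>.
      is_fpath G \<alpha> \<and> is_fpath G \<beta> \<and> A \<in> gen_verts G \<and>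
      path_degree G \<alpha> \<otimes>\<^bsub>free_group (edges G)\<^esub> inv\<^bsub>free_group (edges G)\<^esub> path_degree G \<beta> = t} =
    (lpa_class G ` monomial ` spanning_words t :: ('v, 'e, 'r) free_alg set set)" (is "?L = ?R")
  proof (intro equalityI subsetI)
    fix x assume "x \<in> ?L"
    then obtain \<alpha> A \<beta> where *: "is_fpath G \<alpha>" "is_fpath G \<beta>" "A \<in> gen_verts G"
      "path_degree G \<alpha> \<otimes>\<^bsub>free_group (edges G)\<^esub> inv\<^bsub>free_group (edges G)\<^esub> path_degree G \<beta> = t"
      "x = path_elem G \<alpha> \<otimes>\<^bsub>lpa\<^esub> lpa_class G (P A) \<otimes>\<^bsub>lpa\<^esub> path_elem_star G \<beta>" by blast
    have "word_degree (fpath_word \<alpha> @ GenP A # fpath_star_word \<beta>) = t"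
      using trans[OF degree[OF *(2), symmetric] *(4)] .
    then have "fpath_word \<alpha> @ GenP A # fpath_star_word \<beta> \<in> spanning_words t"
      unfolding spanning_words_def using *(1-3) by (intro CollectI exI conjI) (rule refl)
    then show "x \<in> ?R" unfolding *(5) elem[OF *(1-3)] by (intro imageI)
  next
    fix x assume "x \<in> ?R"
    then obtain \<alpha> A \<beta> where *: "is_fpath G \<alpha>" "is_fpath G \<beta>" "A \<in> gen_verts G"
      "word_degree (fpath_word \<alpha> @ GenP A # fpath_star_word \<beta>) = t"
      "x = lpa_class G (monomial (fpath_word \<alpha> @ GenP A # fpath_star_word \<beta>))"
      unfolding spanning_words_def by blast
    show "x \<in> ?L"
      unfolding *(5) elem[OF *(1-3), symmetric] using *(1-3) trans[OF degree[OF *(2)] *(4)]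
      by (intro CollectI exI conjI) (rule refl)
  qed
  then show ?thesis by (simp add: lpa_component_def)
qed

text \<open>A generalized vertex used as a path of length zero contributes a letter of its own, so a
  spanning word is longer than \<open>nf_word\<close> at an empty end. Choosing \<open>A\<close>
  itself there and using idempotence of its projection bridges the difference.\<close>

lemma nf_word_spanning:
  assumes "path_triple \<alpha> A \<beta>"
  obtains w where "w \<in> spanning_words (word_degree (nf_word \<alpha> A \<beta>))"
    "(monomial (nf_word \<alpha> A \<beta>) :: ('v, 'e, 'r::comm_ring_1) free_alg) \<approx> monomial w"
proof -
  define fp where "fp \<gamma> = (if \<gamma> = [] then GenVertex A else EdgePath \<gamma>)" for \<gamma> :: "'e list"
  have A: "A \<in> gen_verts G" and p: "edge_path G \<alpha>" "edge_path G \<beta>"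
    using assms by (auto simp: path_triple_def)
  have PA: "(monomial [GenP A] :: ('v, 'e, 'r) free_alg) \<approx> monomial [GenP A, GenP A]"
    using P_P_cong[OF A A, THEN lpa_cong_sym] by simp
  have fpath: "is_fpath G (fp \<gamma>)" if "edge_path G \<gamma>" for \<gamma>
    using that A is_fpath_EdgePath_iff[of G \<gamma>] by (cases "\<gamma> = []") (simp_all add: fp_def)
  let ?w = "fpath_word (fp \<alpha>) @ GenP A # fpath_star_word (fp \<beta>)"
  have "(monomial (nf_word \<alpha> A \<beta>) :: ('v, 'e, 'r) free_alg) \<approx>
      monomial (fpath_word (fp \<alpha>) @ GenP A # star_word \<beta>)"
  proof (cases "\<alpha> = []")
    case True
    then show ?thesis
      using lpa_cong_word[OF _ _ PA, of "[]" "star_word \<beta>"] edge_path_edges[OF p(2)]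
      by (simp add: fp_def nf_word_def)
  qed (simp add: fp_def nf_word_def)
  also have "\<dots> \<approx> monomial ?w"
  proof (cases "\<beta> = []")
    case True
    then show ?thesis
      using lpa_cong_word[OF _ _ PA, of "fpath_word (fp \<alpha>)" "[]"] fpath_word_valid[OF fpath[OF p(1)]]
      by (simp add: fp_def)
  qed (simp add: fp_def)
  finally have "(monomial (nf_word \<alpha> A \<beta>) :: ('v, 'e, 'r) free_alg) \<approx> monomial ?w" .
  moreover have "word_degree ?w = word_degree (nf_word \<alpha> A \<beta>)"
    by (simp add: word_degree_def fp_def nf_word_def)
  then have "?w \<in> spanning_words (word_degree (nf_word \<alpha> A \<beta>))"
    unfolding spanning_words_def using A p fpath by blast
  ultimately show ?thesis using that by blast
qed

text \<open>Spanning words have the right degree by construction. Conversely each word of a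
  homogeneous element is zero or congruent to a spanning word of the same degree, so its class is
  reached by adding one word at a time.\<close>

theorem lpa_component_eq:
  "(lpa_component G t :: ('v, 'e, 'r::comm_ring_1) free_alg set set) =
    lpa_class G ` homogeneous G t"
proof (intro equalityI subsetI)
  let ?Y = "monomial ` spanning_words t :: ('v, 'e, 'r) free_alg set"
  have Y: "?Y \<subseteq> free_alg G"
    using spanning_words_homogeneous homogeneous_free_alg by blast
  fix X :: "('v, 'e, 'r) free_alg set"
  {
    assume "X \<in> lpa_component G t"
    then obtain n :: nat and c and y :: "nat \<Rightarrow> ('v, 'e, 'r) free_alg"
      where X: "X = lpa_class G (\<Sum>i<n. scale (c i) (y i))" "\<forall>i<n. y i \<in> ?Y"
      unfolding lpa_component_spanning_words linear_span_class[OF Y] by blast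
    have "y i \<in> homogeneous G t" if "i < n" for i
      using X(2) that spanning_words_homogeneous by blast
    then have "(\<Sum>i<n. scale (c i) (y i)) \<in> homogeneous G t"
      by (intro homogeneous_sum homogeneous_scale) simp
    with X(1) show "X \<in> lpa_class G ` homogeneous G t" by blast
  next
    assume "X \<in> lpa_class G ` homogeneous G t"
    then obtain x where x: "X = lpa_class G x" "x \<in> homogeneous G t" by blast
    let ?s = "\<lambda>w. Poly_Mapping.single w (Poly_Mapping.lookup x w)"
    \<comment> \<open>Membership in \<open>free_alg G\<close> is carried along because the criterion
      for equality of classes asks for a representative there.\<close>
    have "(\<Sum>w\<in>K. ?s w) \<in> free_alg G \<and> lpa_class G (\<Sum>w\<in>K. ?s w) \<in> linear_span lpa (lpa_class G ` ?Y)"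
      if "finite K" "K \<subseteq> Poly_Mapping.keys x" for K
      using that
    proof (induction K)
      case empty
      then show ?case by (simp add: free_alg_zero linear_span_class_zero[OF Y])
    next
      case (insert w K)
      let ?z = "\<Sum>w\<in>K. ?s w"
      have IH: "?z \<in> free_alg G" "lpa_class G ?z \<in> linear_span lpa (lpa_class G ` ?Y)"
        using insert by auto
      have w: "letters w \<noteq> []" "set (letters w) \<subseteq> lpa_gens G" "word_degree (letters w) = t"
        using x(2) insert by (auto simp: homogeneous_def free_alg_def)
      have in_alg: "?s w \<in> free_alg G" by (rule single_free_alg[OF w(1,2)])
      have split: "(\<Sum>w\<in>insert w K. ?s w) = ?z + ?s w" using insert by (simp add: add.commute)
      have "lpa_class G (?z + ?s w) \<in> linear_span lpa (lpa_class G ` ?Y)"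
        using path_normal_form[OF w(1,2), where 'r='r]
      proof (elim disjE exE conjE)
        assume "(monomial (letters w) :: ('v, 'e, 'r) free_alg) \<approx> 0"
        then have "?s w \<approx> 0"
          unfolding single_conv_scale_monomial using lpa_cong_scale by (fastforce simp: scale_def)
        then have "lpa_class G (?z + ?s w) = lpa_class G ?z"
          using lpa_cong_add[OF lpa_cong_refl, of "?s w" 0 ?z] in_alg IH(1)
          by (simp add: class_eq_iff_cong free_alg_add)
        with IH(2) show ?thesis by simp
      next
        fix \<alpha> A \<beta>
        assume nf: "path_triple \<alpha> A \<beta>"
          "(monomial (letters w) :: ('v, 'e, 'r) free_alg) \<approx> monomial (nf_word \<alpha> A \<beta>)"
          "word_degree (nf_word \<alpha> A \<beta>) = word_degree (letters w)"
        obtain w' where w': "w' \<in> spanning_words t"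
          "(monomial (nf_word \<alpha> A \<beta>) :: ('v, 'e, 'r) free_alg) \<approx> monomial w'"
          using nf_word_spanning[OF nf(1)] w(3) nf(3) by metis
        have "?s w \<approx> scale (Poly_Mapping.lookup x w) (monomial w')"
          unfolding single_conv_scale_monomial
          by (rule lpa_cong_scale[OF lpa_cong_trans[OF nf(2) w'(2)]])
        then have "lpa_class G (?z + ?s w) =
            lpa_class G (?z + scale (Poly_Mapping.lookup x w) (monomial w'))"
          using lpa_cong_add[OF lpa_cong_refl] in_alg IH(1)
          by (subst class_eq_iff_cong) (simp_all add: free_alg_add)
        with linear_span_class_add[OF Y IH(1) _ IH(2), of "monomial w'" "Poly_Mapping.lookup x w"] w'(1)
        show ?thesis by simp
      qed
      with in_alg IH(1) show ?case unfolding split by (simp add: free_alg_add)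
    qed
    from this[of "Poly_Mapping.keys x"] show "X \<in> lpa_component G t"
      unfolding lpa_component_spanning_words x(1) by (simp add: sum_single_keys)
  }
qed

lemma homogeneous_induct [consumes 1, case_names zero monomial add]:
  assumes "x \<in> homogeneous G t" "Q 0"
    "\<And>w c. w \<noteq> [] \<Longrightarrow> set w \<subseteq> lpa_gens G \<Longrightarrow> word_degree w = t \<Longrightarrow> Q (scale c (monomial w))"
    "\<And>a b. Q a \<Longrightarrow> Q b \<Longrightarrow> Q (a + b)"
  shows "Q x"
proof (induction x rule: poly_mapping_single_induct)
  case (single w c)
  then have "letters w \<noteq> []" "set (letters w) \<subseteq> lpa_gens G" "word_degree (letters w) = t"
    using assms(1) by (auto simp: homogeneous_def free_alg_def)
  from assms(3)[OF this] show ?case by (simp add: single_conv_scale_monomial)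
qed (use assms in auto)

lemma monomial_mult_scale: "monomial u * scale c (monomial w) = scale c (monomial (u @ w))"
  by (simp add: monomial_def scale_def mult_single plus_free_monoid_def zero_free_monoid_def)

lemma scale_monomial_mult: "scale c (monomial w) * monomial u = scale c (monomial (w @ u))"
  by (simp add: monomial_def scale_def mult_single plus_free_monoid_def zero_free_monoid_def)

section \<open>The axioms of a graded ring\<close>

lemma additive_subgroup_component:
  "additive_subgroup (lpa_component G t :: ('v, 'e, 'r::comm_ring_1) free_alg set set) lpa"
proof (rule additive_subgroupI, rule subgroup.intro)
  show "lpa_component G t \<subseteq> carrier (add_monoid (lpa :: ('r, ('v, 'e, 'r) free_alg set) module))"
    by (auto simp: lpa_component_eq class_in_carrier homogeneous_free_alg)
  show "\<one>\<^bsub>add_monoid lpa\<^esub> \<in> (lpa_component G t :: ('v, 'e, 'r) free_alg set set)"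
    by (auto simp: lpa_component_eq zero_lpa homogeneous_zero)
next
  fix X Y :: "('v, 'e, 'r) free_alg set"
  assume "X \<in> lpa_component G t" "Y \<in> lpa_component G t"
  then show "X \<otimes>\<^bsub>add_monoid lpa\<^esub> Y \<in> lpa_component G t"
    by (auto simp: lpa_component_eq class_add homogeneous_free_alg homogeneous_add)
next
  fix X :: "('v, 'e, 'r) free_alg set"
  assume "X \<in> lpa_component G t"
  then show "inv\<^bsub>add_monoid lpa\<^esub> X \<in> lpa_component G t"
    by (auto simp: lpa_component_eq class_uminus homogeneous_free_alg homogeneous_uminus
        simp flip: a_inv_def)
qed

lemma component_mult:
  "sums_of_products (lpa :: ('r::comm_ring_1, ('v, 'e, 'r) free_alg set) module)
     (lpa_component G s) (lpa_component G t) \<subseteq> lpa_component G (s \<otimes>\<^bsub>free_group X\<^esub> t)"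
proof
  interpret nonunital_ring "lpa :: ('r, ('v, 'e, 'r) free_alg set) module"
    by (rule nonunital_ring_lpa)
  fix z :: "('v, 'e, 'r) free_alg set"
  assume "z \<in> sums_of_products lpa (lpa_component G s) (lpa_component G t)"
  then obtain n :: nat and a b where z: "z = (\<Oplus>\<^bsub>lpa\<^esub>i\<in>{..<n}. a i \<otimes>\<^bsub>lpa\<^esub> b i)"
    "\<forall>i<n. a i \<in> lpa_component G s \<and> b i \<in> lpa_component G t"
    unfolding sums_of_products_def by blast
  then have "\<forall>i. \<exists>x y. i < n \<longrightarrow> x \<in> homogeneous G s \<and> a i = lpa_class G x \<and>
      y \<in> homogeneous G t \<and> b i = lpa_class G y"
    by (simp add: lpa_component_eq image_iff) metis
  then obtain x y where xy: "\<And>i. i < n \<Longrightarrow> x i \<in> homogeneous G s \<and> a i = lpa_class G (x i) \<and>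
      y i \<in> homogeneous G t \<and> b i = lpa_class G (y i)" by metis
  then have alg: "x i \<in> free_alg G" "y i \<in> free_alg G" if "i < n" for i
    using that homogeneous_free_alg by blast+
  have "z = (\<Oplus>\<^bsub>lpa\<^esub>i\<in>{..<n}. lpa_class G (x i * y i))"
    unfolding z(1) using xy alg
    by (intro finsum_cong') (auto simp: class_mult class_in_carrier free_alg_mult)
  also have "\<dots> = lpa_class G (\<Sum>i<n. x i * y i)"
    using alg by (intro class_finsum) (auto simp: free_alg_mult)
  also have "\<dots> \<in> lpa_component G (s \<otimes>\<^bsub>free_group X\<^esub> t)"
    unfolding lpa_component_eq using xy
    by (intro imageI homogeneous_sum homogeneous_mult) auto
  finally show "z \<in> lpa_component G (s \<otimes>\<^bsub>free_group X\<^esub> t)" .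
qed

text \<open>The ideal is stable under taking homogeneous parts. Applied to the difference of two
  representatives of one element, this forces the coefficients of any decomposition to be the
  classes of the homogeneous parts.\<close>

lemma hom_part_unique:
  fixes x :: "('v, 'e, 'r::comm_ring_1) free_alg"
  assumes "x \<in> free_alg G" "finite K" "\<And>g. g \<in> K \<Longrightarrow> y g \<in> homogeneous G g"
    "lpa_class G x = lpa_class G (sum y K)" "t \<in> carrier (free_group (edges G))"
  shows "lpa_class G (hom_part t x) = lpa_class G (if t \<in> K then y t else 0)"
proof -
  have "x - sum y K \<in> lpa_ideal G" using assms by (simp add: class_eq_iff)
  with assms(5) have "hom_part t (x - sum y K) \<in> lpa_ideal G" using hom_part_ideal by blast
  moreover have "hom_part t (sum y K) = (\<Sum>g\<in>K. if t = g then y g else 0)"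
    unfolding hom_part_sum by (intro sum.cong refl hom_part_of_homogeneous[of _ G] assms(3))
  ultimately have "hom_part t x - (if t \<in> K then y t else 0) \<in> lpa_ideal G"
    using assms(2) by (simp add: hom_part_diff)
  then show ?thesis
    using hom_part_homogeneous[OF assms(1), of t] by (simp add: class_eq_iff homogeneous_free_alg)
qed

lemma lpa_direct_sum:
  fixes X :: "('v, 'e, 'r::comm_ring_1) free_alg set"
  assumes "X \<in> carrier lpa"
  defines "F \<equiv> carrier (free_group (edges G))"
  shows "\<exists>!f. f \<in> (\<Pi>\<^sub>E g\<in>F. lpa_component G g) \<and> finite {g \<in> F. f g \<noteq> \<zero>\<^bsub>lpa\<^esub>} \<and>
    X = (\<Oplus>\<^bsub>lpa\<^esub>g\<in>{g \<in> F. f g \<noteq> \<zero>\<^bsub>lpa\<^esub>}. f g)"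
proof -
  interpret nonunital_ring "lpa :: ('r, ('v, 'e, 'r) free_alg set) module"
    by (rule nonunital_ring_lpa)
  obtain x where x: "x \<in> free_alg G" "X = lpa_class G x" using assms by (auto simp: carrier_lpa)
  define D where "D = (\<lambda>w. word_degree (letters w)) ` Poly_Mapping.keys x"
  have D: "finite D" "D \<subseteq> F"
    using x(1) word_degree_carrier by (auto simp: D_def F_def free_alg_def)
  define f where "f = (\<lambda>g\<in>F. lpa_class G (hom_part g x))"
  let ?K = "{g \<in> F. f g \<noteq> \<zero>\<^bsub>lpa\<^esub>}"
  have part: "hom_part g x \<in> free_alg G" for g
    using hom_part_homogeneous[OF x(1)] homogeneous_free_alg by blast
  have outside: "hom_part g x = 0" if "g \<notin> D" for g
    using that by (auto simp: hom_part_def D_def intro!: sum.neutral)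
  have K: "?K \<subseteq> D" using outside by (auto simp: f_def zero_lpa)
  have f: "f \<in> (\<Pi>\<^sub>E g\<in>F. lpa_component G g)"
    unfolding f_def lpa_component_eq using hom_part_homogeneous[OF x(1)] by simp
  have "x = (\<Sum>g\<in>D. hom_part g x)" using sum_hom_part[OF D(1), of x] by (simp add: D_def)
  also have "\<dots> = (\<Sum>g\<in>?K. hom_part g x) + (\<Sum>g\<in>D - ?K. hom_part g x)"
    using D(1) K by (metis (no_types, lifting) add.commute sum.subset_diff)
  finally have "x - (\<Sum>g\<in>?K. hom_part g x) = (\<Sum>g\<in>D - ?K. hom_part g x)"
    by (simp add: algebra_simps)
  \<comment> \<open>A degree in \<open>D - ?K\<close> has a nonzero homogeneous part whose class is
    zero. The decomposition runs only over nonzero classes, so these parts, which lie in the ideal,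
    have to be dropped.\<close>
  moreover have "(\<Sum>g\<in>I. hom_part g x) \<in> lpa_ideal G" if "I \<subseteq> D - ?K" for I
    using finite_subset[OF that] D(1) that
  proof (induction I rule: infinite_finite_induct)
    case (insert g I)
    then have "lpa_class G (hom_part g x) = lpa_class G 0"
      using D(2) by (auto simp: f_def zero_lpa)
    then have "hom_part g x \<in> lpa_ideal G" using part by (simp add: class_eq_iff)
    with insert show ?case by (simp add: lpa_ideal.add)
  qed (simp_all add: lpa_ideal.zero)
  ultimately have "lpa_class G x = lpa_class G (\<Sum>g\<in>?K. hom_part g x)"
    using x(1) by (simp add: class_eq_iff)
  also have "\<dots> = (\<Oplus>\<^bsub>lpa\<^esub>g\<in>?K. lpa_class G (hom_part g x))"
    using K D(1) part by (intro class_finsum[symmetric]) (auto intro: finite_subset)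
  also have "\<dots> = (\<Oplus>\<^bsub>lpa\<^esub>g\<in>?K. f g)"
    using part by (intro finsum_cong') (auto simp: f_def class_in_carrier)
  finally have sum: "X = (\<Oplus>\<^bsub>lpa\<^esub>g\<in>?K. f g)" by (simp add: x)
  show ?thesis
  proof (rule ex1I[of _ f])
    show "f \<in> (\<Pi>\<^sub>E g\<in>F. lpa_component G g) \<and> finite ?K \<and> X = (\<Oplus>\<^bsub>lpa\<^esub>g\<in>?K. f g)"
      using f sum K D(1) finite_subset by blast
  next
    fix f' :: "('e \<times> bool) list \<Rightarrow> ('v, 'e, 'r) free_alg set"
    let ?L = "{g \<in> F. f' g \<noteq> \<zero>\<^bsub>lpa\<^esub>}"
    assume f': "f' \<in> (\<Pi>\<^sub>E g\<in>F. lpa_component G g) \<and> finite ?L \<and> X = (\<Oplus>\<^bsub>lpa\<^esub>g\<in>?L. f' g)"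
    then have "\<forall>g\<in>F. \<exists>y. y \<in> homogeneous G g \<and> f' g = lpa_class G y"
      by (auto simp: lpa_component_eq PiE_iff image_iff)
    then obtain y where y: "\<And>g. g \<in> F \<Longrightarrow> y g \<in> homogeneous G g \<and> f' g = lpa_class G (y g)"
      by metis
    have alg: "y g \<in> free_alg G" if "g \<in> F" for g
      using y[OF that] homogeneous_free_alg by blast
    have "X = (\<Oplus>\<^bsub>lpa\<^esub>g\<in>?L. f' g)" using f' by simp
    also have "\<dots> = (\<Oplus>\<^bsub>lpa\<^esub>g\<in>?L. lpa_class G (y g))"
      using y alg by (intro finsum_cong') (auto simp: class_in_carrier)
    also have "\<dots> = lpa_class G (sum y ?L)"
      using f' alg by (intro class_finsum) auto
    finally have "lpa_class G x = lpa_class G (sum y ?L)" by (simp add: x)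
    \<comment> \<open>Outside \<open>?L\<close> the default 0 agrees with \<open>f' t\<close>, which
      is the zero class there.\<close>
    then have "lpa_class G (hom_part t x) = lpa_class G (if t \<in> ?L then y t else 0)" if "t \<in> F" for t
      using f' y that x(1) unfolding F_def by (intro hom_part_unique) auto
    then have "f' t = f t" if "t \<in> F" for t
      using y[OF that] that by (auto simp: f_def zero_lpa split: if_splits)
    then show "f' = f" using f f' by (intro PiE_ext) auto
  qed
qed

theorem group_graded_ring_lpa:
  "group_graded_ring (lpa :: ('r::comm_ring_1, ('v, 'e, 'r) free_alg set) module)
    (free_group (edges G)) (lpa_component G)"
  by (intro group_graded_ring.intro nonunital_ring_lpa group_free_group
      group_graded_ring_axioms.intro component_mult lpa_direct_sum additive_subgroup_component)

section \<open>Epsilon-strong gradings\<close>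

lemma product_in_sums_of_products:
  fixes X :: "('v, 'e, 'r::comm_ring_1) free_alg set"
  assumes "X \<in> C" "Y \<in> D" "X \<otimes>\<^bsub>lpa\<^esub> Y \<in> carrier lpa"
  shows "X \<otimes>\<^bsub>lpa\<^esub> Y \<in> sums_of_products lpa C D"
proof -
  interpret nonunital_ring "lpa :: ('r, ('v, 'e, 'r) free_alg set) module"
    by (rule nonunital_ring_lpa)
  have "X \<otimes>\<^bsub>lpa\<^esub> Y = (\<Oplus>\<^bsub>lpa\<^esub>i\<in>{..<1::nat}. X \<otimes>\<^bsub>lpa\<^esub> Y)"
    using assms(3) by (simp add: lessThan_Suc)
  with assms(1,2) show ?thesis
    unfolding sums_of_products_def
    by (intro CollectI exI[of _ "1::nat"] exI[of _ "\<lambda>_. X"] exI[of _ "\<lambda>_. Y"]) simp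
qed

lemma zero_in_sums_of_products:
  "\<zero>\<^bsub>lpa\<^esub> \<in> sums_of_products (lpa :: ('r::comm_ring_1, ('v, 'e, 'r) free_alg set) module) C D"
proof -
  interpret nonunital_ring "lpa :: ('r, ('v, 'e, 'r) free_alg set) module"
    by (rule nonunital_ring_lpa)
  show ?thesis
    unfolding sums_of_products_def by (intro CollectI exI[of _ "0::nat"] exI) simp
qed

text \<open>All nonvanishing words of one degree share the reduced pair \<alpha>, \<beta>, because
  the degree determines it; only the common suffix and the middle set depend on the word.\<close>

lemma monomial_pair_normal_form:
  assumes "w \<noteq> []" "set w \<subseteq> lpa_gens G" "word_degree w = pair_word \<alpha> \<beta>" "reduced_pair \<alpha> \<beta>"
  shows "(monomial w :: ('v, 'e, 'r::comm_ring_1) free_alg) \<approx> 0 \<or>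
    (\<exists>\<gamma> A. path_triple (\<alpha> @ \<gamma>) A (\<beta> @ \<gamma>) \<and>
       (monomial w :: ('v, 'e, 'r) free_alg) \<approx> monomial (nf_word (\<alpha> @ \<gamma>) A (\<beta> @ \<gamma>)))"
  using path_normal_form[OF assms(1,2), where 'r='r]
proof (elim disjE exE conjE)
  fix \<alpha>' A \<beta>'
  assume nf: "path_triple \<alpha>' A \<beta>'"
    "(monomial w :: ('v, 'e, 'r) free_alg) \<approx> monomial (nf_word \<alpha>' A \<beta>')"
    "word_degree (nf_word \<alpha>' A \<beta>') = word_degree w"
  obtain \<alpha>'' \<beta>'' \<gamma> where \<gamma>: "\<alpha>' = \<alpha>'' @ \<gamma>" "\<beta>' = \<beta>'' @ \<gamma>" "reduced_pair \<alpha>'' \<beta>''"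
    by (rule common_suffix)
  then have "pair_word \<alpha>'' \<beta>'' = pair_word \<alpha> \<beta>"
    using word_degree_nf_word_pair[OF \<gamma>(3), of \<gamma> A] nf(3) assms(3) by simp
  then show ?thesis using nf \<gamma> by (auto simp: pair_word_inject)
qed simp

text \<open>The right unit condition concerns the component of the inverse degree, so that one
  element per degree suffices: the two conditions on the units at \<open>g\<close> are then the left
  one for \<open>g\<close> and the right one for the inverse of \<open>g\<close>.\<close>

lemma local_unit_exists:
  assumes verts: "verts G \<in> gen_verts G" and t: "t \<in> carrier (free_group (edges G))"
  defines "t' \<equiv> inv\<^bsub>free_group (edges G)\<^esub> t"
  shows "\<exists>E. E \<in> sums_of_products (lpa :: ('r::comm_ring_1, ('v, 'e, 'r) free_alg set) module)
      (lpa_component G t) (lpa_component G t') \<and>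
    (\<forall>s\<in>lpa_component G t. E \<otimes>\<^bsub>lpa\<^esub> s = s) \<and> (\<forall>s\<in>lpa_component G t'. s \<otimes>\<^bsub>lpa\<^esub> E = s)"
proof (cases "\<exists>\<alpha> A \<beta>. path_triple \<alpha> A \<beta> \<and> word_degree (nf_word \<alpha> A \<beta>) = t")
  case True
  then obtain \<alpha> \<beta> \<gamma> A where \<gamma>: "reduced_pair \<alpha> \<beta>" "path_triple (\<alpha> @ \<gamma>) A (\<beta> @ \<gamma>)" "t = pair_word \<alpha> \<beta>"
    using common_suffix word_degree_nf_word_pair by metis
  let ?B = "path_rng G \<beta>"
  have p: "edge_path G \<alpha>" "edge_path G \<beta>" "set \<alpha> \<subseteq> edges G" "set \<beta> \<subseteq> edges G"
    "?B \<in> gen_verts G"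
    using \<gamma>(2) edge_path_edges path_rng_gen_verts[OF verts]
    by (auto simp: path_triple_def edge_path_append)
  have t': "t' = pair_word \<beta> \<alpha>"
    unfolding t'_def \<gamma>(3) by (rule pair_word_inv[OF \<gamma>(1) p(3,4)])
  define e :: "('v, 'e, 'r) free_alg" where "e = monomial (nf_word \<alpha> ?B \<alpha>)"
  define a :: "('v, 'e, 'r) free_alg" where "a = monomial (nf_word \<alpha> ?B \<beta>)"
  define b :: "('v, 'e, 'r) free_alg" where "b = monomial (nf_word \<beta> ?B \<alpha>)"
  have alg: "e \<in> free_alg G" unfolding e_def using p by (intro monomial_free_alg) simp_all
  have a: "a \<in> homogeneous G t"
    unfolding a_def using p word_degree_nf_word_pair[OF \<gamma>(1), of "[]"] \<gamma>(3)
    by (intro homogeneous_monomial) simp_all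
  have b: "b \<in> homogeneous G t'"
    unfolding b_def t' using p word_degree_nf_word_pair[OF reduced_pair_sym[OF \<gamma>(1)], of "[]"]
    by (intro homogeneous_monomial) simp_all
  have "a * b \<approx> e"
    unfolding a_def b_def e_def monomial_mult by (rule local_unit_factor[OF p(1,2,5)])
  then have "lpa_class G e = lpa_class G a \<otimes>\<^bsub>lpa\<^esub> lpa_class G b"
    using a b alg
    by (simp add: class_mult homogeneous_free_alg class_eq_iff_cong lpa_cong_sym)
  moreover have "lpa_class G a \<in> lpa_component G t" "lpa_class G b \<in> lpa_component G t'"
    using a b by (auto simp: lpa_component_eq)
  ultimately have mem: "lpa_class G e \<in> sums_of_products lpa (lpa_component G t) (lpa_component G t')"
    using product_in_sums_of_products[of "lpa_class G a" _ "lpa_class G b"] class_in_carrier[OF alg]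
    by simp
  have left: "e * x \<approx> x" if "x \<in> homogeneous G t" for x
    using that
  proof (induction rule: homogeneous_induct)
    case (monomial w c)
    have "(monomial (nf_word \<alpha> ?B \<alpha> @ w) :: ('v, 'e, 'r) free_alg) \<approx> monomial w"
      using monomial_pair_normal_form[OF monomial(1,2) monomial(3)[unfolded \<gamma>(3)] \<gamma>(1), where 'r='r]
    proof (elim disjE exE conjE)
      assume z: "(monomial w :: ('v, 'e, 'r) free_alg) \<approx> 0"
      have "(monomial (nf_word \<alpha> ?B \<alpha> @ w) :: ('v, 'e, 'r) free_alg) \<approx> 0"
        using lpa_cong_word_zero[OF _ _ z, of "nf_word \<alpha> ?B \<alpha>" "[]"] p by simp
      from lpa_cong_trans[OF this lpa_cong_sym[OF z]] show ?thesis .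
    next
      fix \<gamma> A
      assume nf: "path_triple (\<alpha> @ \<gamma>) A (\<beta> @ \<gamma>)"
        "(monomial w :: ('v, 'e, 'r) free_alg) \<approx> monomial (nf_word (\<alpha> @ \<gamma>) A (\<beta> @ \<gamma>))"
      have "(monomial (nf_word \<alpha> ?B \<alpha> @ w) :: ('v, 'e, 'r) free_alg) \<approx>
          monomial (nf_word \<alpha> ?B \<alpha> @ nf_word (\<alpha> @ \<gamma>) A (\<beta> @ \<gamma>))"
        using lpa_cong_word[OF _ _ nf(2), of "nf_word \<alpha> ?B \<alpha>" "[]"] p by simp
      also have "\<dots> \<approx> monomial (nf_word (\<alpha> @ \<gamma>) A (\<beta> @ \<gamma>))"
        by (rule local_unit_left[OF verts nf(1)])
      also have "\<dots> \<approx> monomial w" by (rule lpa_cong_sym[OF nf(2)])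
      finally show ?thesis .
    qed
    then show ?case unfolding e_def monomial_mult_scale by (rule lpa_cong_scale)
  next
    case (add x y)
    then show ?case by (simp add: distrib_left lpa_cong_add)
  qed simp
  \<comment> \<open>The inverse degree has the pair in reversed order, so
    \<open>local_unit_right\<close> is used with \<alpha> and \<beta> exchanged; its middle set is
    then again the range of \<beta>.\<close>
  have right: "x * e \<approx> x" if "x \<in> homogeneous G t'" for x
    using that
  proof (induction rule: homogeneous_induct)
    case (monomial w c)
    have "(monomial (w @ nf_word \<alpha> ?B \<alpha>) :: ('v, 'e, 'r) free_alg) \<approx> monomial w"
      using monomial_pair_normal_form[OF monomial(1,2) monomial(3)[unfolded t']
          reduced_pair_sym[OF \<gamma>(1)], where 'r='r]
    proof (elim disjE exE conjE)
      assume z: "(monomial w :: ('v, 'e, 'r) free_alg) \<approx> 0"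
      have "(monomial (w @ nf_word \<alpha> ?B \<alpha>) :: ('v, 'e, 'r) free_alg) \<approx> 0"
        using lpa_cong_word_zero[OF _ _ z, of "[]" "nf_word \<alpha> ?B \<alpha>"] p by simp
      from lpa_cong_trans[OF this lpa_cong_sym[OF z]] show ?thesis .
    next
      fix \<gamma> A
      assume nf: "path_triple (\<beta> @ \<gamma>) A (\<alpha> @ \<gamma>)"
        "(monomial w :: ('v, 'e, 'r) free_alg) \<approx> monomial (nf_word (\<beta> @ \<gamma>) A (\<alpha> @ \<gamma>))"
      have "(monomial (w @ nf_word \<alpha> ?B \<alpha>) :: ('v, 'e, 'r) free_alg) \<approx>
          monomial (nf_word (\<beta> @ \<gamma>) A (\<alpha> @ \<gamma>) @ nf_word \<alpha> ?B \<alpha>)"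
        using lpa_cong_word[OF _ _ nf(2), of "[]" "nf_word \<alpha> ?B \<alpha>"] p by simp
      also have "\<dots> \<approx> monomial (nf_word (\<beta> @ \<gamma>) A (\<alpha> @ \<gamma>))"
        by (rule local_unit_right[OF verts nf(1)])
      also have "\<dots> \<approx> monomial w" by (rule lpa_cong_sym[OF nf(2)])
      finally show ?thesis .
    qed
    then show ?case unfolding e_def scale_monomial_mult by (rule lpa_cong_scale)
  next
    case (add x y)
    then show ?case by (simp add: distrib_right lpa_cong_add)
  qed simp
  show ?thesis
    using mem left right alg
    by (intro exI[of _ "lpa_class G e"])
      (auto simp: lpa_component_eq class_mult homogeneous_free_alg class_eq_iff_cong free_alg_mult)
next
  case False
  interpret F: group "free_group (edges G)" by (rule group_free_group)
  \<comment> \<open>Exchanging the two paths of a triple inverts its degree, so \<open>t\<close> is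
    realized by a triple if and only if its inverse is.\<close>
  have none: "\<nexists>\<alpha> A \<beta>. path_triple \<alpha> A \<beta> \<and> word_degree (nf_word \<alpha> A \<beta>) = t'"
  proof (intro notI, elim exE conjE)
    fix \<alpha> A \<beta>
    assume *: "path_triple \<alpha> A \<beta>" "word_degree (nf_word \<alpha> A \<beta>) = t'"
    obtain \<alpha>' \<beta>' \<gamma> where \<gamma>: "\<alpha> = \<alpha>' @ \<gamma>" "\<beta> = \<beta>' @ \<gamma>" "reduced_pair \<alpha>' \<beta>'"
      by (rule common_suffix)
    have sub: "set \<alpha>' \<subseteq> edges G" "set \<beta>' \<subseteq> edges G"
      using *(1) \<gamma> edge_path_edges by (auto simp: path_triple_def edge_path_append)
    have "t = inv\<^bsub>free_group (edges G)\<^esub> t'" using t by (simp add: t'_def)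
    also have "\<dots> = word_degree (nf_word \<beta> A \<alpha>)"
      using *(2) \<gamma> pair_word_inv[OF \<gamma>(3) sub] word_degree_nf_word_pair[OF \<gamma>(3), of \<gamma> A]
        word_degree_nf_word_pair[OF reduced_pair_sym[OF \<gamma>(3)], of \<gamma> A]
      by simp
    finally show False using False path_triple_sym[OF *(1)] by blast
  qed
  have zero: "x \<approx> 0" if "x \<in> homogeneous G s"
    "\<nexists>\<alpha> A \<beta>. path_triple \<alpha> A \<beta> \<and> word_degree (nf_word \<alpha> A \<beta>) = s"
    for x :: "('v, 'e, 'r) free_alg" and s
    using that(1)
  proof (induction rule: homogeneous_induct)
    case (monomial w c)
    then have "(monomial w :: ('v, 'e, 'r) free_alg) \<approx> 0"
      using path_normal_form[OF monomial(1,2), where 'r='r] that(2) by blast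
    from lpa_cong_scale[OF this, of c] show ?case by (simp add: scale_def)
  next
    case (add x y)
    from lpa_cong_add[OF add] show ?case by simp
  qed simp
  have "lpa_component G s = {\<zero>\<^bsub>lpa\<^esub> :: ('v, 'e, 'r) free_alg set}"
    if s: "\<nexists>\<alpha> A \<beta>. path_triple \<alpha> A \<beta> \<and> word_degree (nf_word \<alpha> A \<beta>) = s" for s
  proof -
    have "lpa_class G x = \<zero>\<^bsub>lpa\<^esub>" if x: "x \<in> homogeneous G s" for x :: "('v, 'e, 'r) free_alg"
      using zero[OF x s] homogeneous_free_alg[OF x]
      by (simp add: zero_lpa class_eq_iff_cong)
    then show ?thesis unfolding lpa_component_eq using homogeneous_zero[of G s] by blast
  qed
  then have "lpa_component G t = {\<zero>\<^bsub>lpa\<^esub> :: ('v, 'e, 'r) free_alg set}"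
    "lpa_component G t' = {\<zero>\<^bsub>lpa\<^esub> :: ('v, 'e, 'r) free_alg set}"
    using False none by blast+
  then show ?thesis
    using zero_in_sums_of_products
    by (intro exI[of _ "\<zero>\<^bsub>lpa\<^esub>"]) (simp add: zero_lpa class_mult free_alg_zero)
qed

theorem epsilon_strongly_graded_lpa:
  assumes "verts G \<in> gen_verts G"
  shows "epsilon_strongly_graded_ring
    (lpa :: ('r::comm_ring_1, ('v, 'e, 'r) free_alg set) module)
    (free_group (edges G)) (lpa_component G)"
proof (intro epsilon_strongly_graded_ring.intro group_graded_ring_lpa
    epsilon_strongly_graded_ring_axioms.intro)
  let ?F = "free_group (edges G)"
  interpret F: group ?F by (rule group_free_group)
  have "\<forall>g\<in>carrier ?F. \<exists>E.
      E \<in> sums_of_products (lpa :: ('r, ('v, 'e, 'r) free_alg set) module)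
        (lpa_component G g) (lpa_component G (inv\<^bsub>?F\<^esub> g)) \<and>
      (\<forall>s\<in>lpa_component G g. E \<otimes>\<^bsub>lpa\<^esub> s = s) \<and>
      (\<forall>s\<in>lpa_component G (inv\<^bsub>?F\<^esub> g). s \<otimes>\<^bsub>lpa\<^esub> E = s)"
    using local_unit_exists[OF assms] by (rule ballI)
  from bchoice[OF this] obtain \<epsilon> where \<epsilon>: "\<forall>g\<in>carrier ?F.
      \<epsilon> g \<in> sums_of_products (lpa :: ('r, ('v, 'e, 'r) free_alg set) module)
        (lpa_component G g) (lpa_component G (inv\<^bsub>?F\<^esub> g)) \<and>
      (\<forall>s\<in>lpa_component G g. \<epsilon> g \<otimes>\<^bsub>lpa\<^esub> s = s) \<and>
      (\<forall>s\<in>lpa_component G (inv\<^bsub>?F\<^esub> g). s \<otimes>\<^bsub>lpa\<^esub> \<epsilon> g = s)"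
    by (elim exE)
  show "\<exists>\<epsilon>. \<forall>g\<in>carrier ?F.
      \<epsilon> g \<in> sums_of_products (lpa :: ('r, ('v, 'e, 'r) free_alg set) module)
        (lpa_component G g) (lpa_component G (inv\<^bsub>?F\<^esub> g)) \<and>
      (\<forall>s\<in>lpa_component G g. \<epsilon> g \<otimes>\<^bsub>lpa\<^esub> s = s \<and> s \<otimes>\<^bsub>lpa\<^esub> \<epsilon> (inv\<^bsub>?F\<^esub> g) = s)"
  proof (intro exI[of _ \<epsilon>] ballI conjI)
    fix g assume g: "g \<in> carrier ?F"
    \<comment> \<open>The right unit for the component of \<open>g\<close> is the element chosen for
      the inverse of \<open>g\<close>, whose own inverse is \<open>g\<close> again.\<close>
    note unit = bspec[OF \<epsilon> g] bspec[OF \<epsilon> F.inv_closed[OF g], unfolded F.inv_inv[OF g]]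
    show "\<epsilon> g \<in> sums_of_products lpa (lpa_component G g) (lpa_component G (inv\<^bsub>?F\<^esub> g))"
      by (rule conjunct1[OF unit(1)])
    fix s :: "('v, 'e, 'r) free_alg set"
    assume "s \<in> lpa_component G g"
    with unit show "\<epsilon> g \<otimes>\<^bsub>lpa\<^esub> s = s" "s \<otimes>\<^bsub>lpa\<^esub> \<epsilon> (inv\<^bsub>?F\<^esub> g) = s" by simp_all
  qed
qed

text \<open>For a word, the last letter alone provides \<open>B\<close>.\<close>

lemma P_vertex_annihilates:
  fixes x :: "('v, 'e, 'r::comm_ring_1) free_alg"
  assumes "x \<in> free_alg G"
  shows "\<exists>B\<in>gen_verts G. \<forall>v\<in>verts G - B. x * P {v} \<approx> 0"
proof (induction x rule: poly_mapping_single_induct)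
  case zero
  then show ?case using gen_verts.empty by auto
next
  case (single u c)
  then obtain w g where u: "letters u = w @ [g]" and w: "set w \<subseteq> lpa_gens G" "g \<in> lpa_gens G"
    using assms by (cases "letters u" rule: rev_cases) (auto simp: free_alg_def)
  have "\<exists>B\<in>gen_verts G. \<forall>v\<in>verts G - B.
      (monomial [g, GenP {v}] :: ('v, 'e, 'r) free_alg) \<approx> 0"
  proof (cases g)
    case (GenP A)
    then have A: "A \<in> gen_verts G" using w by simp
    have "(monomial [g, GenP {v}] :: ('v, 'e, 'r) free_alg) \<approx> 0" if "v \<in> verts G - A" for v
      using lpa_cong_trans[OF P_P_cong[OF A gen_verts.vertex[of v]], of 0] P_empty_cong that GenP
      by simp
    with A show ?thesis by blast
  next
    case (GenS e)
    then have e: "e \<in> edges G" using w by simp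
    \<comment> \<open>Inserting the range projection of \<open>e\<close> reduces the product to one
      with the projection of \<open>rng G e \<inter> {v}\<close>, which is empty.\<close>
    have "(monomial [g, GenP {v}] :: ('v, 'e, 'r) free_alg) \<approx> 0" if "v \<in> verts G - rng G e" for v
    proof -
      have v: "{v} \<in> gen_verts G" using that by (simp add: gen_verts.vertex)
      have "(monomial [g, GenP {v}] :: ('v, 'e, 'r) free_alg) \<approx>
          monomial [GenS e, GenP (rng G e), GenP {v}]"
        using lpa_cong_word[OF _ _ S_P_rng_cong[OF e, THEN lpa_cong_sym], of "[]" "[GenP {v}]"]
          GenS v by simp
      also have "\<dots> \<approx> monomial [GenS e, GenP (rng G e \<inter> {v})]"
        using lpa_cong_word[OF _ _ P_P_cong[OF gen_verts.range[OF e] v], of "[GenS e]" "[]"] e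
        by simp
      also have "\<dots> \<approx> 0"
        using lpa_cong_word_zero[OF _ _ P_empty_cong, of "[GenS e]" "[]"] e that by simp
      finally show ?thesis .
    qed
    with gen_verts.range[OF e] show ?thesis by blast
  next
    case (GenSstar e)
    then have e: "e \<in> edges G" using w by simp
    have "(monomial [g, GenP {v}] :: ('v, 'e, 'r) free_alg) \<approx> 0" if "v \<in> verts G - {src G e}" for v
      using Sstar_P_cong[OF gen_verts.vertex[of v] e] that GenSstar by (auto split: if_splits)
    moreover have "{src G e} \<in> gen_verts G" using src_closed[OF e] by (rule gen_verts.vertex)
    ultimately show ?thesis by blast
  qed
  then obtain B where B: "B \<in> gen_verts G" "\<And>v. v \<in> verts G - B \<Longrightarrow>
      (monomial [g, GenP {v}] :: ('v, 'e, 'r) free_alg) \<approx> 0" by blast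
  have "Poly_Mapping.single u c * P {v} \<approx> 0" if v: "v \<in> verts G - B" for v
  proof -
    have "(monomial (letters u @ [GenP {v}]) :: ('v, 'e, 'r) free_alg) \<approx> 0"
      using lpa_cong_word_zero[OF w(1) _ B(2)[OF v], of "[]"] u by simp
    from lpa_cong_scale[OF this, of c] show ?thesis
      by (simp add: single_conv_scale_monomial gens_monomial scale_monomial_mult)
        (simp add: scale_def)
  qed
  with B(1) show ?case by blast
next
  case (add x y)
  \<comment> \<open>The union of the two sets works for the sum and is again a generalized vertex;
    only finitely many words occur, so finite unions are enough.\<close>
  then obtain B C where BC: "B \<in> gen_verts G" "C \<in> gen_verts G"
    "\<forall>v\<in>verts G - B. x * P {v} \<approx> 0" "\<forall>v\<in>verts G - C. y * P {v} \<approx> 0" by blast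
  have "(x + y) * P {v} \<approx> 0" if "v \<in> verts G - (B \<union> C)" for v
    using lpa_cong_add[of "x * P {v}" 0 "y * P {v}" 0] BC that by (simp add: distrib_right)
  with gen_verts.union[OF BC(1,2)] show ?case by blast
qed

text \<open>The neutral degree is the one to examine: every vertex projection lies in that
  component, so its left unit must fix them all and can annihilate none.\<close>

theorem verts_gen_verts_of_epsilon_strongly_graded:
  assumes "epsilon_strongly_graded_ring
    (lpa :: ('r::comm_ring_1, ('v, 'e, 'r) free_alg set) module)
    (free_group (edges G)) (lpa_component G)"
  shows "verts G \<in> gen_verts G"
proof -
  let ?F = "free_group (edges G)" and ?L = "lpa :: ('r, ('v, 'e, 'r) free_alg set) module"
  interpret epsilon_strongly_graded_ring ?L ?F "lpa_component G" by (rule assms)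
  have one: "\<one>\<^bsub>?F\<^esub> = []" "inv\<^bsub>?F\<^esub> [] = []" "[] \<otimes>\<^bsub>?F\<^esub> [] = []" "[] \<in> carrier ?F"
    using group.is_monoid[OF group_free_group, of "edges G"]
      monoid.inv_one[of ?F] by (simp_all add: free_group_def)
  obtain E where E: "E \<in> sums_of_products ?L (lpa_component G []) (lpa_component G [])"
    "\<forall>s\<in>lpa_component G []. E \<otimes>\<^bsub>?L\<^esub> s = s"
    using epsilon one by metis
  \<comment> \<open>Products of neutral elements are neutral, so the unit has a representative in
    the free algebra to which \<open>P_vertex_annihilates\<close> applies.\<close>
  have "E \<in> lpa_component G []" using component_mult[of "[]" "[]"] E(1) one by auto
  then obtain x where x: "x \<in> free_alg G" "E = lpa_class G x"
    by (auto simp: lpa_component_eq dest: homogeneous_free_alg)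
  obtain B where B: "B \<in> gen_verts G" "\<forall>v\<in>verts G - B. x * P {v} \<approx> 0"
    using P_vertex_annihilates[OF x(1)] by blast
  have "v \<in> B" if v: "v \<in> verts G" for v
  proof (rule ccontr)
    assume "v \<notin> B"
    with B(2) v have "x * P {v} \<approx> 0" by blast
    have Pv: "(P {v} :: ('v, 'e, 'r) free_alg) \<in> homogeneous G []"
      unfolding gens_monomial using v by (intro homogeneous_monomial) (auto intro: gen_verts.vertex)
    then have "lpa_class G (P {v} :: ('v, 'e, 'r) free_alg) \<in> lpa_component G []" by (auto simp: lpa_component_eq)
    from bspec[OF E(2) this] have "lpa_class G (P {v}) = E \<otimes>\<^bsub>?L\<^esub> lpa_class G (P {v})" by simp
    also have "\<dots> = lpa_class G (x * P {v})" using x Pv by (simp add: class_mult homogeneous_free_alg)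
    finally have "P {v} \<approx> x * P {v}" using Pv by (simp add: class_eq_iff_cong homogeneous_free_alg)
    from lpa_cong_trans[OF this \<open>x * P {v} \<approx> 0\<close>] show False
      by (simp add: lpa_cong_def vertex_notin_ideal)
  qed
  with gen_verts_subset[OF B(1)] have "verts G = B" by blast
  with B(1) show ?thesis by simp
qed

end

theorem theorem6p5:
  fixes G :: "('v, 'e) ultragraph"
  assumes "ultragraph G" and "edges G \<noteq> {}"
  shows "epsilon_strongly_graded_ring
      (leavitt_path_algebra G :: ('r::comm_ring_1, ('v, 'e, 'r) free_alg set) module)
      (free_group (edges G)) (lpa_component G)
    \<longleftrightarrow> verts G \<in> gen_verts G"
  using ultragraph.epsilon_strongly_graded_lpa[OF assms(1)]
    ultragraph.verts_gen_verts_of_epsilon_strongly_graded[OF assms(1)]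
  by blast

end
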